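(* The variety $\mathsf{var}\{A^1\times B^1\}$ is defined by the following identities: \begin{gather*} x^{2}\approx x^{3},\quad xyx\approx x^{2}yx\approx xyx^{2},\\ xy^{2}x\approx (xy)^2\approx (xy)^2x\approx yx^{2}y\approx (yx)^2,\\ xytxsy\approx (xy)^{2}txsy,\quad xt(yx)^{2}sy\approx xtyxsy,\quad xtysxy\approx xtys(xy)^{2},\\ xy_{1}^{2}y_{2}^{2}\cdots y_{n}^{2}x\approx xy_{1}^{2}xy_{2}^{2}x\cdots y_{n}^{2}x,\qquad n=2,3,\ldots,\\ xytxz_{1}^{2}\cdots z_{n}^{2}y\approx yxtxz_{1}^{2}\cdots z_{n}^{2}y,\qquad n=0,1,\ldots,\\ xz_{1}^{2}\cdots z_{n}^{2}ytxy\approx xz_{1}^{2}\cdots z_{n}^{2}ytyx,\qquad n=0,1,\ldots. \end{gather*}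
   Context: $A=\{0,a,b,c,d,e\}$ is the semigroup with zero $0$ whose nonzero products are exactly $ae=a$, $be=b$, $cb=a$, $cd=c$, $db=b$, $dd=d$, $ea=a$, $eb=a$, $ec=c$, $ed=c$, $ee=e$ (all other products equal $0$). $B$ is the semigroup dual (anti-isomorphic) to $A$. $A^1$ and $B^1$ are the monoids obtained from $A$ and $B$ by adjoining an identity element. $\mathsf{var}\{A^1\times B^1\}$ is the semigroup variety generated by $A^1\times B^1$. The variety defined by a set $\Pi$ of identities is the class of all semigroups satisfying every identity in $\Pi$. In the last two families, for $n=0$ the product $z_1^2\cdots z_n^2$ is empty. *)

theory Defs
  imports "HOL-Library.FuncSet"
begin

section \<open>Semigroups\<close>

record 'a sgrp =
  carrier :: "'a set"
  mult :: "'a \<Rightarrow> 'a \<Rightarrow> 'a"  (infixl "\<cdot>\<index>" 70)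

locale semigrp =
  fixes S :: "'a sgrp" (structure)
  assumes nonempty: "carrier S \<noteq> {}"
    and closed: "\<lbrakk>x \<in> carrier S; y \<in> carrier S\<rbrakk> \<Longrightarrow> x \<cdot> y \<in> carrier S"
    and assoc: "\<lbrakk>x \<in> carrier S; y \<in> carrier S; z \<in> carrier S\<rbrakk> \<Longrightarrow> (x \<cdot> y) \<cdot> z = x \<cdot> (y \<cdot> z)"

definition dual :: "'a sgrp \<Rightarrow> 'a sgrp" where
  "dual S = \<lparr>carrier = carrier S, mult = (\<lambda>x y. y \<cdot>\<^bsub>S\<^esub> x)\<rparr>"

text \<open>The adjoined identity is \<^term>\<open>None\<close>; it is new even if the semigroup already has an identity.\<close>

definition adjoin_one :: "'a sgrp \<Rightarrow> 'a option sgrp" where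
  "adjoin_one S = \<lparr>carrier = insert None (Some ` carrier S),
     mult = (\<lambda>x y. case x of None \<Rightarrow> y
               | Some a \<Rightarrow> (case y of None \<Rightarrow> x | Some b \<Rightarrow> Some (a \<cdot>\<^bsub>S\<^esub> b)))\<rparr>"

definition direct_prod :: "'a sgrp \<Rightarrow> 'b sgrp \<Rightarrow> ('a \<times> 'b) sgrp" where
  "direct_prod S T = \<lparr>carrier = carrier S \<times> carrier T,
     mult = (\<lambda>(x, y) (x', y'). (x \<cdot>\<^bsub>S\<^esub> x', y \<cdot>\<^bsub>T\<^esub> y'))\<rparr>"

definition direct_power :: "'a sgrp \<Rightarrow> 'i set \<Rightarrow> ('i \<Rightarrow> 'a) sgrp" where
  "direct_power S I = \<lparr>carrier = (\<Pi>\<^sub>E i\<in>I. carrier S), mult = (\<lambda>f g. \<lambda>i\<in>I. f i \<cdot>\<^bsub>S\<^esub> g i)\<rparr>"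

definition subsemigroup :: "'a set \<Rightarrow> 'a sgrp \<Rightarrow> bool" where
  "subsemigroup U S \<longleftrightarrow> U \<subseteq> carrier S \<and> U \<noteq> {} \<and> (\<forall>x\<in>U. \<forall>y\<in>U. x \<cdot>\<^bsub>S\<^esub> y \<in> U)"

definition restrict_to :: "'a sgrp \<Rightarrow> 'a set \<Rightarrow> 'a sgrp" where
  "restrict_to S U = \<lparr>carrier = U, mult = mult S\<rparr>"

definition surj_hom :: "('a \<Rightarrow> 'b) \<Rightarrow> 'a sgrp \<Rightarrow> 'b sgrp \<Rightarrow> bool" where
  "surj_hom h S T \<longleftrightarrow> h ` carrier S = carrier T \<and>
     (\<forall>x\<in>carrier S. \<forall>y\<in>carrier S. h (x \<cdot>\<^bsub>S\<^esub> y) = h x \<cdot>\<^bsub>T\<^esub> h y)"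

section \<open>Generated varieties\<close>

text \<open>\<open>HSP TYPE('i) S T\<close>: \<open>T\<close> is a homomorphic image of a subsemigroup of a direct power of \<open>S\<close>,
  where the index set of the power is any (possibly empty) set of elements of type \<open>'i\<close>.\<close>

definition HSP :: "'i itself \<Rightarrow> 'b sgrp \<Rightarrow> 'a sgrp \<Rightarrow> bool" where
  "HSP _ S T \<longleftrightarrow> (\<exists>(I :: 'i set) U h.
     subsemigroup U (direct_power S I) \<and> surj_hom h (restrict_to (direct_power S I) U) T)"

text \<open>The variety generated by \<open>S\<close>, restricted to semigroups with elements in \<open>'a\<close>. HOL cannot
  quantify over the type of the index set inside a definition; the type \<open>'a \<Rightarrow> 'b\<close> is always
  large enough, see \<open>HSP_index_type\<close> below.\<close>

definition var_gen :: "'b sgrp \<Rightarrow> 'a sgrp set" where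
  "var_gen S = {T. semigrp T \<and> HSP TYPE('a \<Rightarrow> 'b) S T}"

lemma HSP_index_type:
  fixes S :: "'b sgrp" and T :: "'a sgrp"
  assumes "HSP TYPE('i) S T"
  shows "HSP TYPE('a \<Rightarrow> 'b) S T"
proof -
  obtain I :: "'i set" and U h where U: "subsemigroup U (direct_power S I)"
    and h: "surj_hom h (restrict_to (direct_power S I) U) T"
    using assms unfolding HSP_def by blast
  have U_sub: "U \<subseteq> (\<Pi>\<^sub>E i\<in>I. carrier S)" and U_ne: "U \<noteq> {}"
    and U_cl: "\<And>v w. v \<in> U \<Longrightarrow> w \<in> U \<Longrightarrow> (\<lambda>i\<in>I. v i \<cdot>\<^bsub>S\<^esub> w i) \<in> U"
    using U by (auto simp: subsemigroup_def direct_power_def)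
  have h_im: "h ` U = carrier T"
    and h_hom: "\<And>v w. v \<in> U \<Longrightarrow> w \<in> U \<Longrightarrow> h (\<lambda>i\<in>I. v i \<cdot>\<^bsub>S\<^esub> w i) = h v \<cdot>\<^bsub>T\<^esub> h w"
    using h by (auto simp: surj_hom_def restrict_to_def direct_power_def)
  define u where "u = inv_into U h"
  have u: "u t \<in> U \<and> h (u t) = t" if "t \<in> carrier T" for t
    using that unfolding u_def h_im[symmetric] by (simp add: inv_into_into f_inv_into_f)
  define \<phi> where "\<phi> i = (\<lambda>t. u t i)" for i
  define J where "J = \<phi> ` I"
  define pull where "pull w = (\<lambda>i\<in>I. w (\<phi> i))" for w :: "('a \<Rightarrow> 'b) \<Rightarrow> 'b"
  define V where "V = {w \<in> (\<Pi>\<^sub>E j\<in>J. carrier S). pull w \<in> U}"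
  have pull_mult: "pull (\<lambda>j\<in>J. v j \<cdot>\<^bsub>S\<^esub> w j) = (\<lambda>i\<in>I. pull v i \<cdot>\<^bsub>S\<^esub> pull w i)" for v w
    by (auto simp: pull_def J_def fun_eq_iff)
  have ev: "(\<lambda>p\<in>J. p t) \<in> V \<and> h (pull (\<lambda>p\<in>J. p t)) = t" if t: "t \<in> carrier T" for t
  proof -
    have ut: "u t \<in> (\<Pi>\<^sub>E i\<in>I. carrier S)" using u[OF t] U_sub by blast
    have "pull (\<lambda>p\<in>J. p t) = (\<lambda>i\<in>I. u t i)"
      by (auto simp: pull_def J_def \<phi>_def fun_eq_iff)
    also have "\<dots> = u t" using ut by (simp add: PiE_iff extensional_restrict)
    finally have "pull (\<lambda>p\<in>J. p t) = u t" .
    moreover have "(\<lambda>p\<in>J. p t) \<in> (\<Pi>\<^sub>E j\<in>J. carrier S)"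
      using ut by (auto simp: J_def \<phi>_def PiE_iff)
    ultimately show ?thesis using u[OF t] by (simp add: V_def)
  qed
  have V_cl: "(\<lambda>j\<in>J. v j \<cdot>\<^bsub>S\<^esub> w j) \<in> V" if vw: "v \<in> V" "w \<in> V" for v w
  proof -
    have pU: "(\<lambda>i\<in>I. pull v i \<cdot>\<^bsub>S\<^esub> pull w i) \<in> U"
      using vw U_cl by (auto simp: V_def)
    have "v (\<phi> i) \<cdot>\<^bsub>S\<^esub> w (\<phi> i) \<in> carrier S" if "i \<in> I" for i
      using U_sub pU that by (force simp: pull_def PiE_iff)
    then have "(\<lambda>j\<in>J. v j \<cdot>\<^bsub>S\<^esub> w j) \<in> (\<Pi>\<^sub>E j\<in>J. carrier S)" by (auto simp: J_def)
    then show ?thesis using pU by (simp add: V_def pull_mult)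
  qed
  have "h ` U \<noteq> {}" using U_ne by blast
  then have "V \<noteq> {}" using ev h_im by blast
  then have "subsemigroup V (direct_power S J)"
    using V_cl by (auto simp: subsemigroup_def direct_power_def V_def)
  moreover have "surj_hom (\<lambda>w. h (pull w)) (restrict_to (direct_power S J) V) T"
  proof -
    have "(\<lambda>w. h (pull w)) ` V \<subseteq> carrier T" using h_im by (auto simp: V_def)
    moreover have "carrier T \<subseteq> (\<lambda>w. h (pull w)) ` V" using ev by force
    ultimately have "(\<lambda>w. h (pull w)) ` V = carrier T" by (rule antisym)
    moreover have "h (pull (\<lambda>j\<in>J. v j \<cdot>\<^bsub>S\<^esub> w j)) = h (pull v) \<cdot>\<^bsub>T\<^esub> h (pull w)"
      if "v \<in> V" "w \<in> V" for v w
      unfolding pull_mult using that h_hom by (simp add: V_def)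
    ultimately show ?thesis
      by (simp add: surj_hom_def restrict_to_def direct_power_def)
  qed
  ultimately show ?thesis unfolding HSP_def by blast
qed

section \<open>Identities\<close>

text \<open>Words are lists of letters. Semigroup words are nonempty, so the value of the empty word
  is left unspecified; it does not occur in any identity below.\<close>

fun word_val :: "'a sgrp \<Rightarrow> ('v \<Rightarrow> 'a) \<Rightarrow> 'v list \<Rightarrow> 'a" where
  "word_val S \<theta> [] = undefined"
| "word_val S \<theta> [v] = \<theta> v"
| "word_val S \<theta> (v # w # ws) = \<theta> v \<cdot>\<^bsub>S\<^esub> word_val S \<theta> (w # ws)"

type_synonym 'v identity = "'v list \<times> 'v list"

definition satisfies :: "'a sgrp \<Rightarrow> 'v identity \<Rightarrow> bool" where
  "satisfies S e \<longleftrightarrow>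
     (\<forall>\<theta>. (\<forall>v. \<theta> v \<in> carrier S) \<longrightarrow> word_val S \<theta> (fst e) = word_val S \<theta> (snd e))"

definition var_defined_by :: "'v identity set \<Rightarrow> 'a sgrp set" where
  "var_defined_by E = {T. semigrp T \<and> (\<forall>e\<in>E. satisfies T e)}"

section \<open>The semigroups \<open>A\<close> and \<open>B\<close>\<close>

datatype elt = Zero | Ea | Eb | Ec | Ed | Ee

fun A_mult :: "elt \<Rightarrow> elt \<Rightarrow> elt" where
  "A_mult Ea Ee = Ea"
| "A_mult Eb Ee = Eb"
| "A_mult Ec Eb = Ea"
| "A_mult Ec Ed = Ec"
| "A_mult Ed Eb = Eb"
| "A_mult Ed Ed = Ed"
| "A_mult Ee Ea = Ea"
| "A_mult Ee Eb = Ea"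
| "A_mult Ee Ec = Ec"
| "A_mult Ee Ed = Ec"
| "A_mult Ee Ee = Ee"
| "A_mult _ _ = Zero"

definition sgA :: "elt sgrp" where
  "sgA = \<lparr>carrier = UNIV, mult = A_mult\<rparr>"

definition sgB :: "elt sgrp" where
  "sgB = dual sgA"

definition A1xB1 :: "(elt option \<times> elt option) sgrp" where
  "A1xB1 = direct_prod (adjoin_one sgA) (adjoin_one sgB)"

lemma A_mult_assoc: "A_mult (A_mult u v) w = A_mult u (A_mult v w)"
  by (cases u; cases v; cases w; simp)

lemma semigrp_sgA: "semigrp sgA"
  by (simp add: semigrp_def sgA_def A_mult_assoc)

lemma semigrp_dual: "semigrp S \<Longrightarrow> semigrp (dual S)"
  by (simp add: semigrp_def dual_def)

lemma semigrp_adjoin_one: "semigrp S \<Longrightarrow> semigrp (adjoin_one S)"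
  by (auto simp: semigrp_def adjoin_one_def)

lemma semigrp_direct_prod: "semigrp S \<Longrightarrow> semigrp T \<Longrightarrow> semigrp (direct_prod S T)"
  by (auto simp: semigrp_def direct_prod_def)

lemma semigrp_A1xB1: "semigrp A1xB1"
  unfolding A1xB1_def sgB_def
  by (intro semigrp_direct_prod semigrp_adjoin_one semigrp_dual semigrp_sgA)

section \<open>The system of identities\<close>

text \<open>\<open>Y i\<close> and \<open>Z i\<close> stand for the indexed variables $y_i$ and $z_i$.\<close>

datatype letter = x | y | t | s | Y nat | Z nat

text \<open>\<open>chain [u\<^sub>1, \<dots>, u\<^sub>k]\<close> stands for $u_1 \approx u_2 \approx \cdots \approx u_k$.\<close>

definition chain :: "'v list list \<Rightarrow> 'v identity set" where
  "chain us = set (zip us (tl us))"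

text \<open>$z_1^2 z_2^2 \cdots z_n^2$ (empty for \<open>n = 0\<close>), $y_1^2 y_2^2 \cdots y_n^2$, and
  $y_1^2 x y_2^2 x \cdots y_n^2 x$.\<close>

definition z_squares :: "nat \<Rightarrow> letter list" where
  "z_squares n = concat (map (\<lambda>i. [Z i, Z i]) [1..<Suc n])"

definition y_squares :: "nat \<Rightarrow> letter list" where
  "y_squares n = concat (map (\<lambda>i. [Y i, Y i]) [1..<Suc n])"

definition y_squares_x :: "nat \<Rightarrow> letter list" where
  "y_squares_x n = concat (map (\<lambda>i. [Y i, Y i, x]) [1..<Suc n])"

definition basis :: "letter identity set" where
  "basis =
     chain [[x,x], [x,x,x]]
   \<union> chain [[x,y,x], [x,x,y,x], [x,y,x,x]]
   \<union> chain [[x,y,y,x], [x,y,x,y], [x,y,x,y,x], [y,x,x,y], [y,x,y,x]]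
   \<union> chain [[x,y,t,x,s,y], [x,y,x,y,t,x,s,y]]
   \<union> chain [[x,t,y,x,y,x,s,y], [x,t,y,x,s,y]]
   \<union> chain [[x,t,y,s,x,y], [x,t,y,s,x,y,x,y]]
   \<union> (\<Union>n\<in>{2..}. chain [[x] @ y_squares n @ [x], [x] @ y_squares_x n])
   \<union> (\<Union>n\<in>{0..}. chain [[x,y,t,x] @ z_squares n @ [y], [y,x,t,x] @ z_squares n @ [y]])
   \<union> (\<Union>n\<in>{0..}. chain [[x] @ z_squares n @ [y,t,x,y], [x] @ z_squares n @ [y,t,y,x]])"

hide_const (open) x y t s Y Z

end

theory Submission
  imports Defs
begin

text \<open>The identities of the basis hold in \<open>A\<^sup>1 \<times> B\<^sup>1\<close> by a finite check: in \<open>A\<^sup>1\<close> a product of squares can only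
take the values \<open>1, e, d, c, 0\<close>, which bounds the three infinite families. Conversely, by Birkhoff's
argument (\<open>HSP_of_identities\<close>) it suffices that every identity \<open>u \<approx> v\<close> of \<open>A\<^sup>1 \<times> B\<^sup>1\<close> can be derived
from the basis (\<open>deriv_iff_ident\<close>).

A semigroup product in \<open>A\<close> of the generators \<open>e, d, b\<close> is nonzero iff it lies in \<open>e\<^sup>*d\<^sup>*\<close> or
\<open>e\<^sup>*d\<^sup>*be\<^sup>*\<close>. Hence an identity of \<open>A\<^sup>1\<close> preserves the set of linear letters (those that occur exactly
once), the relation ``all \<open>p\<close> precede all \<open>q\<close>'' (\<open>ident_prec\<close>), and its relativisation to the part of the
word before a linear letter \<open>z\<close> that follows all \<open>q\<close> (\<open>ident_prec_upto\<close>); an identity of \<open>B\<^sup>1\<close> preserves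
the mirror images of these. The linear letters cut a word into blocks. It follows that \<open>u\<close> and \<open>v\<close> have the
same linear letters in the same order, that corresponding blocks have the same content, and that inside
corresponding blocks the relation ``all \<open>p\<close> precede all \<open>q\<close>'' agrees for certain pairs \<open>(p, q)\<close>: those that are
\<open>determined\<close>, by \<open>A\<^sup>1\<close> or in the mirrored sense by \<open>B\<^sup>1\<close>, which depends only on the contents of the other blocks.

Inside a block, where no letter is linear, letters may be doubled, and a letter \<open>a\<close> may be inserted anywhere
between two of its occurrences; so a block amounts to an arrangement of the first and last occurrences of its
letters (\<open>deriv_arrangement\<close>). Neighbouring first occurrences may be exchanged, and so may neighbouring last
occurrences; and if \<open>(p, q)\<close> is determined in neither sense, then one of the identities with the letters \<open>t\<close> and \<open>s\<close> or
of the families with squares lets the last occurrence of \<open>p\<close> be exchanged with a neighbouring first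
occurrence of \<open>q\<close> (\<open>deriv_swap_end_start\<close>). Two arrangements whose disagreements are all of these
kinds can be transformed into each other by such exchanges, as in a partially commutative monoid (\<open>trace_equiv\<close>).
Thus a block of \<open>u\<close> can be turned into the corresponding block of \<open>v\<close> (\<open>deriv_block\<close>), and induction on
the number of remaining letters finishes the proof (\<open>deriv_of_ident_prefix\<close>).\<close>

section \<open>The identities of \<open>A\<^sup>1\<close> and \<open>B\<^sup>1\<close>\<close>

text \<open>The multiplication of \<open>A\<^sup>1\<close>, with \<^term>\<open>None\<close> as identity element.\<close>

fun mulA :: "elt option \<Rightarrow> elt option \<Rightarrow> elt option" where
  "mulA None v = v"
| "mulA (Some a) None = Some a"
| "mulA (Some a) (Some b) = Some (A_mult a b)"

text \<open>The value of a word in \<open>A\<^sup>1\<close>. Unlike \<^const>\<open>word_val\<close> it is meaningful for the empty word,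
  whose value is the identity element.\<close>

fun val :: "('v \<Rightarrow> elt option) \<Rightarrow> 'v list \<Rightarrow> elt option" where
  "val \<theta> [] = None"
| "val \<theta> (a # w) = mulA (\<theta> a) (val \<theta> w)"

text \<open>\<open>u \<approx> v\<close> is an identity of \<open>A\<^sup>1\<close> and of \<open>B\<^sup>1\<close>. As \<open>B\<^sup>1\<close> is dual to \<open>A\<^sup>1\<close>, the latter is
  expressed by the reversed words.\<close>

definition ident :: "'v list \<Rightarrow> 'v list \<Rightarrow> bool" where
  "ident u v \<longleftrightarrow> (\<forall>\<theta>. val \<theta> u = val \<theta> v \<and> val \<theta> (rev u) = val \<theta> (rev v))"

lemma mulA_None [simp]: "mulA a None = a"
  by (cases a) auto

lemma mulA_assoc: "mulA (mulA u v) w = mulA u (mulA v w)"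
  by (cases u; cases v; cases w; simp add: A_mult_assoc)

lemma val_append: "val \<theta> (u @ v) = mulA (val \<theta> u) (val \<theta> v)"
  by (induction u) (auto simp: mulA_assoc)

lemma mult_A1: "mult (adjoin_one sgA) a b = mulA a b"
  by (cases a; cases b) (simp_all add: adjoin_one_def sgA_def)

lemma mult_B1: "mult (adjoin_one sgB) a b = mulA b a"
  by (cases a; cases b) (simp_all add: adjoin_one_def sgA_def sgB_def dual_def)

lemma mult_A1xB1: "mult A1xB1 g h = (mulA (fst g) (fst h), mulA (snd h) (snd g))"
  by (simp add: A1xB1_def direct_prod_def mult_A1 mult_B1 split: prod.split)

lemma carrier_A1xB1: "carrier A1xB1 = UNIV"
  by (simp add: A1xB1_def direct_prod_def adjoin_one_def sgA_def sgB_def dual_def flip: UNIV_option_conv)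

lemma word_val_A1xB1:
  "w \<noteq> [] \<Longrightarrow> word_val A1xB1 \<theta> w = (val (fst \<circ> \<theta>) w, val (snd \<circ> \<theta>) (rev w))"
  by (induction A1xB1 \<theta> w rule: word_val.induct) (simp_all add: mult_A1xB1 val_append mulA_assoc)

lemma ident_iff_satisfies:
  assumes "u \<noteq> []" "v \<noteq> []"
  shows "satisfies A1xB1 (u, v) \<longleftrightarrow> ident u v"
proof
  assume s: "satisfies A1xB1 (u, v)"
  show "ident u v"
    unfolding ident_def
  proof (intro allI)
    fix \<theta>
    show "val \<theta> u = val \<theta> v \<and> val \<theta> (rev u) = val \<theta> (rev v)"
      using s[unfolded satisfies_def carrier_A1xB1, rule_format, of "\<lambda>a. (\<theta> a, \<theta> a)"] assms
      by (simp add: word_val_A1xB1 comp_def)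
  qed
next
  assume "ident u v"
  then show "satisfies A1xB1 (u, v)"
    using assms by (simp add: satisfies_def word_val_A1xB1 ident_def)
qed

text \<open>The squares of \<open>A\<^sup>1\<close> together with \<open>c = ed\<close>: the submonoid generated by the squares, in \<open>A\<^sup>1\<close> as
  well as in \<open>B\<^sup>1\<close>.\<close>

definition sqs :: "elt option set" where
  "sqs = {None, Some Ee, Some Ed, Some Ec, Some Zero}"

lemma A1_cases:
  obtains "a = None" | "a = Some Zero" | "a = Some Ea" | "a = Some Eb" | "a = Some Ec"
    | "a = Some Ed" | "a = Some Ee"
proof (cases a)
  case (Some b)
  then show ?thesis using that by (cases b) auto
qed (use that in auto)

lemma mulA_Zero [simp]: "mulA (Some Zero) a = Some Zero" "mulA a (Some Zero) = Some Zero"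
  by (cases a rule: A1_cases; simp)+

lemma sq_in: "mulA a a \<in> sqs"
  by (cases a rule: A1_cases) (auto simp: sqs_def)

lemma None_sqs: "None \<in> sqs"
  by (simp add: sqs_def)

lemma sqs_mult: "a \<in> sqs \<Longrightarrow> b \<in> sqs \<Longrightarrow> mulA a b \<in> sqs"
  by (auto simp: sqs_def)

lemma val_squares:
  "val \<theta> (concat (map (\<lambda>i. [f i, f i]) ns)) \<in> sqs"
  "val \<theta> (rev (concat (map (\<lambda>i. [f i, f i]) ns))) \<in> sqs"
proof -
  have "mulA a (mulA a b) \<in> sqs" if "b \<in> sqs" for a b
    using sqs_mult[OF sq_in that] by (simp add: mulA_assoc)
  then show "val \<theta> (concat (map (\<lambda>i. [f i, f i]) ns)) \<in> sqs"
    by (induction ns) (simp_all add: None_sqs)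
  show "val \<theta> (rev (concat (map (\<lambda>i. [f i, f i]) ns))) \<in> sqs"
    by (induction ns) (simp_all add: None_sqs val_append mulA_assoc sqs_mult sq_in)
qed

text \<open>The family \<open>x y\<^sub>1\<^sup>2 \<dots> y\<^sub>n\<^sup>2 x \<approx> x y\<^sub>1\<^sup>2 x \<dots> y\<^sub>n\<^sup>2 x\<close>. One induction step needs \<open>XPXqX = XPqX\<close> only for \<open>P\<close> a
  product of squares and \<open>q\<close> a square, which are finitely many cases.\<close>

lemma val_squares_x:
  "ns \<noteq> [] \<Longrightarrow> val \<theta> (a # concat (map (\<lambda>i. [f i, f i]) ns) @ [a]) = val \<theta> (a # concat (map (\<lambda>i. [f i, f i, a]) ns))"
proof (induction ns rule: rev_induct)
  case Nil
  then show ?case by simp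
next
  case (snoc n ns)
  show ?case
  proof (cases "ns = []")
    case True
    then show ?thesis by simp
  next
    case False
    let ?P = "val \<theta> (concat (map (\<lambda>i. [f i, f i]) ns))" and ?q = "mulA (\<theta> (f n)) (\<theta> (f n))"
    have key: "mulA X (mulA P (mulA X (mulA q X))) = mulA X (mulA P (mulA q X))"
      if "P \<in> sqs" "q \<in> sqs" for X P q
      using that unfolding sqs_def by (cases X rule: A1_cases) auto
    have "val \<theta> (a # concat (map (\<lambda>i. [f i, f i, a]) (ns @ [n])))
        = mulA (val \<theta> (a # concat (map (\<lambda>i. [f i, f i, a]) ns))) (mulA ?q (\<theta> a))"
      by (simp add: val_append mulA_assoc)
    also have "\<dots> = mulA (\<theta> a) (mulA ?P (mulA (\<theta> a) (mulA ?q (\<theta> a))))"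
      unfolding snoc.IH[OF False, symmetric] by (simp add: val_append mulA_assoc)
    also have "\<dots> = mulA (\<theta> a) (mulA ?P (mulA ?q (\<theta> a)))"
      by (rule key[OF val_squares(1) sq_in])
    finally show ?thesis by (simp add: val_append mulA_assoc)
  qed
qed

lemma chain_simps [simp]:
  "chain [u, v] = {(u, v)}"
  "chain (u # v # w # ws) = insert (u, v) (chain (v # w # ws))"
  by (auto simp: chain_def)

lemma rev_concat_y: "rev (concat (map (\<lambda>i. [f i, f i]) ns)) = concat (map (\<lambda>i. [f i, f i]) (rev ns))"
  by (induction ns) auto

lemma rev_concat_x: "rev (a # concat (map (\<lambda>i. [f i, f i, a]) ns)) = a # concat (map (\<lambda>i. [f i, f i, a]) (rev ns))"
  by (induction ns) auto

lemma mulA_xytxsy: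
  "mulA X (mulA Y (mulA T (mulA X (mulA S Y)))) =
    mulA X (mulA Y (mulA X (mulA Y (mulA T (mulA X (mulA S Y))))))"
  by (cases X rule: A1_cases; cases Y rule: A1_cases; (simp; fail)?;
      cases T rule: A1_cases; (simp; fail)?; cases S rule: A1_cases; simp)

lemma mulA_xytxsy_rev:
  "mulA Y (mulA S (mulA X (mulA T (mulA Y X)))) =
    mulA Y (mulA S (mulA X (mulA T (mulA Y (mulA X (mulA Y X))))))"
  by (cases X rule: A1_cases; cases Y rule: A1_cases; (simp; fail)?;
      cases T rule: A1_cases; (simp; fail)?; cases S rule: A1_cases; simp)

lemma mulA_xtyxsy:
  "mulA X (mulA T (mulA Y (mulA X (mulA Y (mulA X (mulA S Y)))))) =
    mulA X (mulA T (mulA Y (mulA X (mulA S Y))))"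
  by (cases X rule: A1_cases; cases Y rule: A1_cases; (simp; fail)?;
      cases T rule: A1_cases; (simp; fail)?; cases S rule: A1_cases; simp)

lemma mulA_swap:
  assumes "q \<in> sqs"
  shows "mulA X (mulA Y (mulA T (mulA X (mulA q Y)))) = mulA Y (mulA X (mulA T (mulA X (mulA q Y))))"
  using assms unfolding sqs_def
  by (cases X rule: A1_cases; cases Y rule: A1_cases; (simp; fail)?; cases T rule: A1_cases; auto)

lemma mulA_swap_rev:
  assumes "q \<in> sqs"
  shows "mulA Y (mulA q (mulA X (mulA T (mulA Y X)))) = mulA Y (mulA q (mulA X (mulA T (mulA X Y))))"
  using assms unfolding sqs_def
  by (cases X rule: A1_cases; cases Y rule: A1_cases; (simp; fail)?; cases T rule: A1_cases; auto)

lemma mulA_small: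
  "mulA X X = mulA X (mulA X X)"
  "mulA X (mulA Y X) = mulA X (mulA X (mulA Y X))"
  "mulA X (mulA X (mulA Y X)) = mulA X (mulA Y (mulA X X))"
  "mulA X (mulA Y (mulA Y X)) = mulA X (mulA Y (mulA X Y))"
  "mulA X (mulA Y (mulA X Y)) = mulA X (mulA Y (mulA X (mulA Y X)))"
  "mulA X (mulA Y (mulA X (mulA Y X))) = mulA Y (mulA X (mulA X Y))"
  "mulA Y (mulA X (mulA X Y)) = mulA Y (mulA X (mulA Y X))"
  "mulA X (mulA Y X) = mulA X (mulA Y (mulA X X))"
  "mulA X (mulA Y (mulA X X)) = mulA X (mulA X (mulA Y X))"
  "mulA X (mulA Y (mulA Y X)) = mulA Y (mulA X (mulA Y X))"
  "mulA Y (mulA X (mulA Y X)) = mulA X (mulA Y (mulA X (mulA Y X)))"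
  "mulA Y (mulA X (mulA X Y)) = mulA X (mulA Y (mulA X Y))"
  by (cases X rule: A1_cases; (simp; fail)?; cases Y rule: A1_cases; simp)+

lemma ident_squares_x:
  assumes "ns \<noteq> []"
  shows "ident (a # concat (map (\<lambda>i. [f i, f i]) ns) @ [a]) (a # concat (map (\<lambda>i. [f i, f i, a]) ns))"
proof -
  have "rev (a # concat (map (\<lambda>i. [f i, f i]) ns) @ [a]) = a # concat (map (\<lambda>i. [f i, f i]) (rev ns)) @ [a]"
    by (simp add: rev_concat_y)
  then show ?thesis
    using val_squares_x[OF assms, of _ a f] val_squares_x[of "rev ns" _ a f] assms
    unfolding ident_def rev_concat_x by simp
qed

lemma ident_swap:
  "ident ([a,b,c,a] @ concat (map (\<lambda>i. [f i, f i]) ns) @ [b])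
     ([b,a,c,a] @ concat (map (\<lambda>i. [f i, f i]) ns) @ [b])"
  unfolding ident_def
  by (intro allI conjI; simp add: val_append mulA_assoc;
      rule mulA_swap[OF val_squares(1)] mulA_swap_rev[OF val_squares(2)])

lemma ident_swap_rev:
  "ident ([a] @ concat (map (\<lambda>i. [f i, f i]) ns) @ [b,c,a,b])
     ([a] @ concat (map (\<lambda>i. [f i, f i]) ns) @ [b,c,b,a])"
  unfolding ident_def
  by (intro allI conjI; simp add: val_append mulA_assoc;
      rule mulA_swap[OF val_squares(2)] mulA_swap_rev[OF val_squares(1)])

lemma ident_small:
  "ident [a,a] [a,a,a]"
  "ident [a,b,a] [a,a,b,a]" "ident [a,a,b,a] [a,b,a,a]"
  "ident [a,b,b,a] [a,b,a,b]" "ident [a,b,a,b] [a,b,a,b,a]" "ident [a,b,a,b,a] [b,a,a,b]"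
  "ident [b,a,a,b] [b,a,b,a]"
  "ident [a,b,c,a,d,b] [a,b,a,b,c,a,d,b]"
  "ident [a,c,b,a,b,a,d,b] [a,c,b,a,d,b]"
  "ident [a,c,b,d,a,b] [a,c,b,d,a,b,a,b]"
  unfolding ident_def rev.simps append.simps val.simps mulA_None
  by (intro allI conjI mulA_small mulA_xytxsy mulA_xytxsy_rev mulA_xtyxsy)+

lemma basis_ident: "e \<in> basis \<Longrightarrow> ident (fst e) (snd e)"
proof -
  have "\<forall>e\<in>basis. ident (fst e) (snd e)"
    unfolding basis_def ball_Un ball_UN y_squares_def y_squares_x_def z_squares_def
    by (intro conjI)
      (simp_all add: ident_small ident_squares_x[simplified] ident_swap[simplified] ident_swap_rev[simplified]
         del: upt_Suc)
  then show "e \<in> basis \<Longrightarrow> ident (fst e) (snd e)" by blast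
qed

section \<open>Derivations from the basis\<close>

text \<open>Equational consequence of the basis. Letters are replaced by nonempty words only, since a semigroup
  need not have an identity element; the empty word is derivable only from itself.\<close>

inductive deriv :: "'v list \<Rightarrow> 'v list \<Rightarrow> bool" where
  inst: "e \<in> basis \<Longrightarrow> (\<And>l. \<sigma> l \<noteq> []) \<Longrightarrow> deriv (concat (map \<sigma> (fst e))) (concat (map \<sigma> (snd e)))"
| refl: "deriv w w"
| sym: "deriv u v \<Longrightarrow> deriv v u"
| trans: "deriv u v \<Longrightarrow> deriv v w \<Longrightarrow> deriv u w"
| ctx: "deriv u v \<Longrightarrow> deriv (p @ u @ q) (p @ v @ q)"

declare deriv.trans [trans]

lemma val_subst: "val \<theta> (concat (map \<sigma> w)) = val (\<lambda>l. val \<theta> (\<sigma> l)) w"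
  by (induction w) (simp_all add: val_append)

lemma rev_subst: "rev (concat (map \<sigma> w)) = concat (map (\<lambda>l. rev (\<sigma> l)) (rev w))"
  by (induction w) simp_all

lemma deriv_ident: "deriv u v \<Longrightarrow> ident u v"
proof (induction rule: deriv.induct)
  case (inst e \<sigma>)
  then show ?case
    using basis_ident[of e] by (simp add: ident_def rev_subst val_subst)
qed (simp_all add: ident_def val_append)

context semigrp
begin

lemma word_val_closed:
  assumes "\<And>a. \<theta> a \<in> carrier S" "u \<noteq> []"
  shows "word_val S \<theta> u \<in> carrier S"
  using assms(2)
proof (induction u rule: list_nonempty_induct)
  case (cons a w)
  then show ?case using assms(1) closed by (cases w) auto
qed (simp add: assms)

lemma word_val_append:
  assumes th: "\<And>a. \<theta> a \<in> carrier S" and "u \<noteq> []" and v: "v \<noteq> []"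
  shows "word_val S \<theta> (u @ v) = word_val S \<theta> u \<cdot> word_val S \<theta> v"
  using assms(2)
proof (induction u rule: list_nonempty_induct)
  case (single a)
  then show ?case using v by (cases v) auto
next
  case (cons a w)
  then show ?case
    using th closed assoc word_val_closed[of \<theta> w] word_val_closed[of \<theta> v] v by (cases w) auto
qed

lemma word_val_subst:
  assumes th: "\<And>a. \<theta> a \<in> carrier S" and s: "\<And>l. \<sigma> l \<noteq> []" and "w \<noteq> []"
  shows "word_val S \<theta> (concat (map \<sigma> w)) = word_val S (\<lambda>l. word_val S \<theta> (\<sigma> l)) w"
  using assms(3)
proof (induction w rule: list_nonempty_induct)
  case (cons a w)
  moreover have "concat (map \<sigma> w) \<noteq> []" using cons(1) s by (cases w) auto
  ultimately show ?case
    using word_val_append[of \<theta> "\<sigma> a" "concat (map \<sigma> w)"] th s by (cases w) auto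
qed simp

lemma deriv_sound:
  assumes "deriv u v" "\<forall>e\<in>basis. satisfies S e" and th: "\<And>a. \<theta> a \<in> carrier S"
  shows "(u = [] \<longleftrightarrow> v = []) \<and> word_val S \<theta> u = word_val S \<theta> v"
  using assms(1)
proof (induction rule: deriv.induct)
  case (inst e \<sigma>)
  have ne: "fst e \<noteq> [] \<and> snd e \<noteq> []"
    using inst(1) by (auto simp: basis_def)
  have "concat (map \<sigma> w) \<noteq> []" if "w \<noteq> []" for w
    using that inst(2) by (cases w) auto
  moreover have "satisfies S e" using inst(1) assms(2) by blast
  ultimately show ?case
    using ne word_val_subst[of \<theta> \<sigma>] th inst(2) word_val_closed[of \<theta>]
    by (simp add: satisfies_def)
next
  case (ctx u v p q)
  show ?case
  proof (cases "u = []")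
    case False
    then have "v \<noteq> []" using ctx by auto
    then have "word_val S \<theta> (u @ q) = word_val S \<theta> (v @ q)"
      using False ctx word_val_append[of \<theta> _ q] th by (cases "q = []") auto
    then show ?thesis
      using False \<open>v \<noteq> []\<close> word_val_append[of \<theta> p] th by (cases "p = []") auto
  qed (use ctx in auto)
qed auto

end

text \<open>The substitution that sends \<open>x, y, t, s\<close> to given words and both \<open>y\<^sub>i\<close> and \<open>z\<^sub>i\<close> to \<open>f i\<close>.\<close>

fun sub :: "'v list \<Rightarrow> 'v list \<Rightarrow> 'v list \<Rightarrow> 'v list \<Rightarrow> (nat \<Rightarrow> 'v list) \<Rightarrow> letter \<Rightarrow> 'v list" where
  "sub a b c d f letter.x = a"
| "sub a b c d f letter.y = b"
| "sub a b c d f letter.t = c"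
| "sub a b c d f letter.s = d"
| "sub a b c d f (letter.Y i) = f i"
| "sub a b c d f (letter.Z i) = f i"

lemma deriv_sub:
  assumes "(u, v) \<in> basis" "a \<noteq> []" "b \<noteq> []" "c \<noteq> []" "d \<noteq> []" "\<And>i. f i \<noteq> []"
  shows "deriv (concat (map (sub a b c d f) u)) (concat (map (sub a b c d f) v))"
proof -
  have "sub a b c d f l \<noteq> []" for l using assms(2-) by (cases l) auto
  then show ?thesis using deriv.inst[OF assms(1), of "sub a b c d f"] by simp
qed

text \<open>The identities of the basis with arbitrary nonempty words in place of their letters.\<close>

lemma deriv_small:
  assumes "a \<noteq> []" "b \<noteq> []"
  shows deriv_sq: "deriv (a @ a) (a @ a @ a)"
    and deriv_left: "deriv (a @ b @ a) (a @ a @ b @ a)"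
    and deriv_left': "deriv (a @ a @ b @ a) (a @ b @ a @ a)"
    and deriv_band1: "deriv (a @ b @ b @ a) (a @ b @ a @ b)"
    and deriv_band2: "deriv (a @ b @ a @ b) (a @ b @ a @ b @ a)"
    and deriv_band3: "deriv (a @ b @ a @ b @ a) (b @ a @ a @ b)"
    and deriv_band4: "deriv (b @ a @ a @ b) (b @ a @ b @ a)"
  using assms
    deriv_sub[of "[letter.x,letter.x]" "[letter.x,letter.x,letter.x]" a b a a "\<lambda>_. a"]
    deriv_sub[of "[letter.x,letter.y,letter.x]" "[letter.x,letter.x,letter.y,letter.x]" a b a a "\<lambda>_. a"]
    deriv_sub[of "[letter.x,letter.x,letter.y,letter.x]" "[letter.x,letter.y,letter.x,letter.x]" a b a a "\<lambda>_. a"]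
    deriv_sub[of "[letter.x,letter.y,letter.y,letter.x]" "[letter.x,letter.y,letter.x,letter.y]" a b a a "\<lambda>_. a"]
    deriv_sub[of "[letter.x,letter.y,letter.x,letter.y]" "[letter.x,letter.y,letter.x,letter.y,letter.x]" a b a a "\<lambda>_. a"]
    deriv_sub[of "[letter.x,letter.y,letter.x,letter.y,letter.x]" "[letter.y,letter.x,letter.x,letter.y]" a b a a "\<lambda>_. a"]
    deriv_sub[of "[letter.y,letter.x,letter.x,letter.y]" "[letter.y,letter.x,letter.y,letter.x]" a b a a "\<lambda>_. a"]
  by (simp_all add: basis_def)

lemma deriv_spread:
  assumes "a \<noteq> []" "b \<noteq> []" "c \<noteq> []" "d \<noteq> []"
  shows deriv_first: "deriv (a @ b @ c @ a @ d @ b) (a @ b @ a @ b @ c @ a @ d @ b)"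
    and deriv_middle: "deriv (a @ c @ b @ a @ b @ a @ d @ b) (a @ c @ b @ a @ d @ b)"
    and deriv_last: "deriv (a @ c @ b @ d @ a @ b) (a @ c @ b @ d @ a @ b @ a @ b)"
  using assms
    deriv_sub[of "[letter.x,letter.y,letter.t,letter.x,letter.s,letter.y]" "[letter.x,letter.y,letter.x,letter.y,letter.t,letter.x,letter.s,letter.y]" a b c d "\<lambda>_. a"]
    deriv_sub[of "[letter.x,letter.t,letter.y,letter.x,letter.y,letter.x,letter.s,letter.y]" "[letter.x,letter.t,letter.y,letter.x,letter.s,letter.y]" a b c d "\<lambda>_. a"]
    deriv_sub[of "[letter.x,letter.t,letter.y,letter.s,letter.x,letter.y]" "[letter.x,letter.t,letter.y,letter.s,letter.x,letter.y,letter.x,letter.y]" a b c d "\<lambda>_. a"]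
  by (simp_all add: basis_def)

text \<open>With \<open>d\<close> the empty word, a list of nonempty words is the list of values at \<open>1, \<dots>, n\<close> of a substitution.\<close>

lemma list_as_map:
  assumes "\<forall>w\<in>set ws. w \<noteq> d" "a \<noteq> d"
  obtains f where "\<And>i. f i \<noteq> d" "map f [1..<Suc (length ws)] = ws"
proof
  let ?f = "\<lambda>i. if i - 1 < length ws then ws ! (i - 1) else a"
  show "?f i \<noteq> d" for i using assms by auto
  show "map ?f [1..<Suc (length ws)] = ws"
    by (rule nth_equalityI) (auto simp del: upt_Suc)
qed

lemma concat_map_singles:
  "concat (map \<sigma> (concat (map (\<lambda>i. [g i, g i]) is))) = concat (map (\<lambda>w. w @ w) (map (\<lambda>i. \<sigma> (g i)) is))"
  "concat (map \<sigma> (concat (map (\<lambda>i. [g i, g i, a]) is))) = concat (map (\<lambda>w. w @ w @ \<sigma> a) (map (\<lambda>i. \<sigma> (g i)) is))"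
  by (induction "is") simp_all

lemma deriv_families:
  assumes "a \<noteq> []" "b \<noteq> []" "c \<noteq> []" "\<forall>w\<in>set ws. w \<noteq> []"
  shows deriv_saturate: "length ws \<ge> 2 \<Longrightarrow>
      deriv (a @ concat (map (\<lambda>w. w @ w) ws) @ a) (a @ concat (map (\<lambda>w. w @ w @ a) ws))"
    and deriv_swap: "deriv (a @ b @ c @ a @ concat (map (\<lambda>w. w @ w) ws) @ b)
      (b @ a @ c @ a @ concat (map (\<lambda>w. w @ w) ws) @ b)"
    and deriv_swap_rev: "deriv (a @ concat (map (\<lambda>w. w @ w) ws) @ b @ c @ a @ b)
      (a @ concat (map (\<lambda>w. w @ w) ws) @ b @ c @ b @ a)"
proof -
  let ?n = "length ws"
  obtain f where ne: "\<And>i. f i \<noteq> []" and f: "map f [1..<Suc ?n] = ws"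
    using list_as_map[of ws "[]" a] assms by blast
  have eY: "map (\<lambda>i. sub a b c a f (letter.Y i)) [1..<Suc ?n] = ws"
    and eZ: "map (\<lambda>i. sub a b c a f (letter.Z i)) [1..<Suc ?n] = ws"
    using f by simp_all
  have b: "?n \<ge> 2 \<Longrightarrow> ([letter.x] @ y_squares ?n @ [letter.x], [letter.x] @ y_squares_x ?n) \<in> basis"
    "([letter.x,letter.y,letter.t,letter.x] @ z_squares ?n @ [letter.y], [letter.y,letter.x,letter.t,letter.x] @ z_squares ?n @ [letter.y]) \<in> basis"
    "([letter.x] @ z_squares ?n @ [letter.y,letter.t,letter.x,letter.y], [letter.x] @ z_squares ?n @ [letter.y,letter.t,letter.y,letter.x]) \<in> basis"
    unfolding basis_def by (auto simp: atLeast_iff)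
  note e = y_squares_def y_squares_x_def z_squares_def map_append concat_append concat_map_singles
    eY eZ fst_conv snd_conv
  show "length ws \<ge> 2 \<Longrightarrow>
      deriv (a @ concat (map (\<lambda>w. w @ w) ws) @ a) (a @ concat (map (\<lambda>w. w @ w @ a) ws))"
    using deriv_sub[OF b(1), of a b c a f] ne assms(1-3) unfolding e by simp
  show "deriv (a @ b @ c @ a @ concat (map (\<lambda>w. w @ w) ws) @ b)
      (b @ a @ c @ a @ concat (map (\<lambda>w. w @ w) ws) @ b)"
    using deriv_sub[OF b(2), of a b c a f] ne assms(1-3) unfolding e by simp
  show "deriv (a @ concat (map (\<lambda>w. w @ w) ws) @ b @ c @ a @ b)
      (a @ concat (map (\<lambda>w. w @ w) ws) @ b @ c @ b @ a)"
    using deriv_sub[OF b(3), of a b c a f] ne assms(1-3) unfolding e by simp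
qed

text \<open>The basis is closed under reversal up to derivability, so derivations may be read from right to left.\<close>

lemma deriv_basis_rev:
  "\<forall>e\<in>basis. \<forall>\<sigma>. (\<forall>l. \<sigma> l \<noteq> []) \<longrightarrow>
     deriv (concat (map \<sigma> (rev (fst e)))) (concat (map \<sigma> (rev (snd e))))"
proof -
  have band: "deriv (a @ b @ b @ a) (b @ a @ b @ a)" "deriv (b @ a @ b @ a) (a @ b @ a @ b @ a)"
    "deriv (b @ a @ a @ b) (a @ b @ a @ b)" "deriv (a @ b @ a) (a @ b @ a @ a)"
    "deriv (a @ b @ a @ a) (a @ a @ b @ a)"
    if ne: "a \<noteq> []" "b \<noteq> []" for a b :: "'a list"
  proof -
    note d = deriv_band1[OF ne] deriv_band2[OF ne] deriv_band3[OF ne] deriv_band4[OF ne]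
    show "deriv (a @ b @ b @ a) (b @ a @ b @ a)"
      by (rule d(1)[THEN deriv.trans, OF d(2)[THEN deriv.trans], OF d(3)[THEN deriv.trans], OF d(4)])
    show "deriv (b @ a @ b @ a) (a @ b @ a @ b @ a)"
      by (rule deriv.trans[OF d(4)[THEN deriv.sym] d(3)[THEN deriv.sym]])
    show "deriv (b @ a @ a @ b) (a @ b @ a @ b)"
      by (rule deriv.trans[OF d(3)[THEN deriv.sym] d(2)[THEN deriv.sym]])
    show "deriv (a @ b @ a) (a @ b @ a @ a)"
      by (rule deriv.trans[OF deriv_left[OF ne] deriv_left'[OF ne]])
    show "deriv (a @ b @ a @ a) (a @ a @ b @ a)"
      by (rule deriv_left'[OF ne, THEN deriv.sym])
  qed
  have sq: "deriv (a @ a) (a @ a @ a)" if "a \<noteq> []" for a :: "'a list"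
    by (rule deriv_sq[OF that that])
  have sat: "deriv (\<sigma> letter.x @ concat (map (\<lambda>w. w @ w) (map (\<lambda>i. \<sigma> (letter.Y i)) is)) @ \<sigma> letter.x)
      (\<sigma> letter.x @ concat (map (\<lambda>w. w @ w @ \<sigma> letter.x) (map (\<lambda>i. \<sigma> (letter.Y i)) is)))"
    if "length is \<ge> 2" "\<forall>l. \<sigma> l \<noteq> []" for \<sigma> :: "letter \<Rightarrow> 'a list" and "is"
    using that by (intro deriv_saturate[of _ "\<sigma> letter.x" "\<sigma> letter.x"]) auto
  have swap: "deriv (a @ b @ c @ a @ concat (map (\<lambda>w. w @ w) (map (\<lambda>i. \<sigma> (letter.Z i)) is)) @ b)
      (b @ a @ c @ a @ concat (map (\<lambda>w. w @ w) (map (\<lambda>i. \<sigma> (letter.Z i)) is)) @ b)"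
     "deriv (a @ concat (map (\<lambda>w. w @ w) (map (\<lambda>i. \<sigma> (letter.Z i)) is)) @ b @ c @ a @ b)
      (a @ concat (map (\<lambda>w. w @ w) (map (\<lambda>i. \<sigma> (letter.Z i)) is)) @ b @ c @ b @ a)"
    if "a \<noteq> []" "b \<noteq> []" "c \<noteq> []" "\<forall>l. \<sigma> l \<noteq> []" for \<sigma> :: "letter \<Rightarrow> 'a list" and "is" a b c
    by (rule deriv_swap deriv_swap_rev; use that in auto)+
  have rx: "rev (y_squares_x n) @ [letter.x] =
      letter.x # concat (map (\<lambda>i. [letter.Y i, letter.Y i, letter.x]) (rev [1..<Suc n]))" for n
    using rev_concat_x[of letter.x letter.Y "[1..<Suc n]"] by (simp add: y_squares_x_def del: upt_Suc)
  show ?thesis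
    unfolding basis_def ball_Un ball_UN
  proof (intro conjI)
    show "\<forall>n\<in>{2..}. \<forall>e\<in>chain [[letter.x] @ y_squares n @ [letter.x], [letter.x] @ y_squares_x n].
       \<forall>\<sigma>. (\<forall>l. \<sigma> l \<noteq> []) \<longrightarrow> deriv (concat (map \<sigma> (rev (fst e)))) (concat (map \<sigma> (rev (snd e))) :: 'a list)"
      unfolding chain_simps using sat[of "rev [1..<Suc n]" for n]
      by (simp add: rx y_squares_def rev_concat_y concat_map_singles del: upt_Suc)
    show "\<forall>n\<in>{0..}. \<forall>e\<in>chain [[letter.x, letter.y, letter.t, letter.x] @ z_squares n @ [letter.y],
           [letter.y, letter.x, letter.t, letter.x] @ z_squares n @ [letter.y]].
       \<forall>\<sigma>. (\<forall>l. \<sigma> l \<noteq> []) \<longrightarrow> deriv (concat (map \<sigma> (rev (fst e)))) (concat (map \<sigma> (rev (snd e))) :: 'a list)"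
      unfolding chain_simps z_squares_def using swap(2)
      by (simp add: rev_concat_y concat_map_singles del: upt_Suc)
    show "\<forall>n\<in>{0..}. \<forall>e\<in>chain [[letter.x] @ z_squares n @ [letter.y, letter.t, letter.x, letter.y],
           [letter.x] @ z_squares n @ [letter.y, letter.t, letter.y, letter.x]].
       \<forall>\<sigma>. (\<forall>l. \<sigma> l \<noteq> []) \<longrightarrow> deriv (concat (map \<sigma> (rev (fst e)))) (concat (map \<sigma> (rev (snd e))) :: 'a list)"
      unfolding chain_simps z_squares_def using swap(1)
      by (simp add: rev_concat_y concat_map_singles del: upt_Suc)
  qed (simp_all add: sq band deriv_band3 deriv_first deriv_middle deriv_last)
qed

lemma deriv_rev: "deriv u v \<Longrightarrow> deriv (rev u) (rev v)"
proof (induction rule: deriv.induct)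
  case (inst e \<sigma>)
  then show ?case
    using deriv_basis_rev[rule_format, of e "\<lambda>l. rev (\<sigma> l)"] by (simp add: rev_subst)
next
  case (ctx u v p q)
  then show ?case using deriv.ctx[of "rev u" "rev v" "rev q" "rev p"] by simp
qed (auto intro: deriv.intros)

lemma deriv_rev_iff: "deriv (rev u) (rev v) \<longleftrightarrow> deriv u v"
  using deriv_rev[of u v] deriv_rev[of "rev u" "rev v"] by auto

lemma ident_rev: "ident u v \<Longrightarrow> ident (rev u) (rev v)"
  by (simp add: ident_def)

lemma ident_sym: "ident u v \<Longrightarrow> ident v u"
  by (simp add: ident_def)

lemma ident_trans: "ident u v \<Longrightarrow> ident v w \<Longrightarrow> ident u w"
  by (simp add: ident_def)

section \<open>Order relations preserved by identities\<close>

text \<open>All occurrences of \<open>p\<close> in \<open>w\<close> precede all occurrences of \<open>q\<close>. Either letter may be absent from \<open>w\<close>.\<close>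

definition prec :: "'v list \<Rightarrow> 'v \<Rightarrow> 'v \<Rightarrow> bool" where
  "prec w p q \<longleftrightarrow> (\<exists>w1 w2. w = w1 @ w2 \<and> q \<notin> set w1 \<and> p \<notin> set w2)"

text \<open>The letters of \<open>L\<close> occur in \<open>w\<close> exactly once altogether, namely at \<open>z\<close>; every \<open>q\<close> is to the left of this
  place, and every \<open>p\<close> on its left precedes every \<open>q\<close>. Nothing is required of the \<open>p\<close> on its right.\<close>

definition prec_upto :: "'v list \<Rightarrow> 'v set \<Rightarrow> 'v \<Rightarrow> 'v \<Rightarrow> bool" where
  "prec_upto w L p q \<longleftrightarrow> (\<exists>w1 w2 z w3. w = w1 @ w2 @ z # w3 \<and> z \<in> L \<and>
     (set w1 \<union> set w2 \<union> set w3) \<inter> L = {} \<and> q \<notin> set w1 \<union> set w3 \<and> p \<notin> set w2)"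

text \<open>The substitution \<open>p \<mapsto> e\<close>, \<open>q \<mapsto> d\<close> and \<open>z \<mapsto> b\<close> for \<open>z \<in> L\<close>, all other letters going to the identity
  element. For distinct \<open>p, q\<close> outside \<open>L\<close>, it evaluates a word to a nonzero element exactly if these letters
  occur in the order \<open>e\<^sup>*d\<^sup>*\<close> or
  \<open>e\<^sup>*d\<^sup>*be\<^sup>*\<close>.\<close>

definition test :: "'v \<Rightarrow> 'v \<Rightarrow> 'v set \<Rightarrow> 'v \<Rightarrow> elt option" where
  "test p q L l = (if l \<in> L then Some Eb else if l = p then Some Ee else if l = q then Some Ed else None)"

lemma prec_Cons: "l \<noteq> q \<Longrightarrow> prec w p q \<Longrightarrow> prec (l # w) p q"
  unfolding prec_def by (metis append_Cons set_ConsD)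

lemma prec_Cons': "l \<noteq> q \<Longrightarrow> p \<notin> set w \<Longrightarrow> prec (l # w) p q"
  unfolding prec_def by (intro exI[of _ "[l]"] exI[of _ w]) auto

lemma prec_upto_Cons: "l \<noteq> q \<Longrightarrow> l \<notin> L \<Longrightarrow> prec_upto w L p q \<Longrightarrow> prec_upto (l # w) L p q"
  unfolding prec_upto_def
  by (elim exE, rename_tac w1 w2 z w3, rule_tac x="l # w1" in exI) auto

text \<open>The case of \<^const>\<open>prec_upto\<close> with no \<open>p\<close> before \<open>z\<close>; it describes the words with value \<open>b\<close>.\<close>

definition upto0 :: "'v list \<Rightarrow> 'v set \<Rightarrow> 'v \<Rightarrow> 'v \<Rightarrow> bool" where
  "upto0 w L p q \<longleftrightarrow> (\<exists>w2 z w3. w = w2 @ z # w3 \<and> z \<in> L \<and>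
     (set w2 \<union> set w3) \<inter> L = {} \<and> q \<notin> set w3 \<and> p \<notin> set w2)"

lemma upto0_imp: "upto0 w L p q \<Longrightarrow> prec_upto w L p q"
  unfolding upto0_def prec_upto_def by (metis append_Nil empty_iff empty_set Un_empty_left)

lemma upto0_Cons: "l \<noteq> p \<Longrightarrow> l \<notin> L \<Longrightarrow> upto0 w L p q \<Longrightarrow> upto0 (l # w) L p q"
  unfolding upto0_def
  by (elim exE, rename_tac w2 z w3, rule_tac x="l # w2" in exI) auto

lemma upto0_Cons': "z \<in> L \<Longrightarrow> set w \<inter> L = {} \<Longrightarrow> q \<notin> set w \<Longrightarrow> upto0 (z # w) L p q"
  unfolding upto0_def by (intro exI[of _ "[]"] exI[of _ z] exI[of _ w]) auto

lemma test_shape: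
  assumes "p \<noteq> q" "p \<notin> L" "q \<notin> L"
  shows "(case val (test p q L) w of
      None \<Rightarrow> p \<notin> set w \<and> q \<notin> set w \<and> set w \<inter> L = {}
    | Some Ee \<Rightarrow> q \<notin> set w \<and> set w \<inter> L = {}
    | Some Ed \<Rightarrow> p \<notin> set w \<and> set w \<inter> L = {}
    | Some Ec \<Rightarrow> prec w p q
    | Some Eb \<Rightarrow> upto0 w L p q
    | Some Ea \<Rightarrow> prec_upto w L p q
    | Some Zero \<Rightarrow> True)"
proof (induction w)
  case Nil
  then show ?case by simp
next
  case (Cons l w)
  consider "l \<in> L" | "l = p" | "l = q" | "l \<notin> L" "l \<noteq> p" "l \<noteq> q" by blast
  then show ?case
  proof cases
    case 1
    then have "test p q L l = Some Eb" by (simp add: test_def)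
    then show ?thesis using Cons 1
      by (cases "val (test p q L) w" rule: A1_cases) (auto intro: upto0_Cons')
  next
    case 2
    then have "test p q L l = Some Ee" using assms by (simp add: test_def)
    then show ?thesis using Cons 2 assms
      by (cases "val (test p q L) w" rule: A1_cases)
        (auto intro: prec_Cons prec_Cons' prec_upto_Cons upto0_imp)
  next
    case 3
    then have "test p q L l = Some Ed" using assms by (simp add: test_def)
    then show ?thesis using Cons 3 assms
      by (cases "val (test p q L) w" rule: A1_cases) (auto intro: upto0_Cons)
  next
    case 4
    then have "test p q L l = None" by (simp add: test_def)
    then show ?thesis using Cons 4
      by (cases "val (test p q L) w" rule: A1_cases)
        (auto intro: prec_Cons prec_upto_Cons upto0_Cons)
  qed
qed

lemma val_in_pair:
  assumes "\<And>l. l \<in> set w \<Longrightarrow> \<theta> l = None \<or> \<theta> l = Some f" "A_mult f f = f"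
  shows "val \<theta> w = None \<or> val \<theta> w = Some f"
  using assms by (induction w) fastforce+

lemma ident_prec:
  assumes "ident u v" "p \<noteq> q" "prec u p q"
  shows "prec v p q"
proof -
  let ?t = "test p q {}"
  obtain u1 u2 where u: "u = u1 @ u2" "q \<notin> set u1" "p \<notin> set u2"
    using assms(3) by (auto simp: prec_def)
  have "val ?t u1 = None \<or> val ?t u1 = Some Ee"
    by (rule val_in_pair) (use u in \<open>auto simp: test_def\<close>)
  moreover have "val ?t u2 = None \<or> val ?t u2 = Some Ed"
    by (rule val_in_pair) (use u in \<open>auto simp: test_def\<close>)
  ultimately have "val ?t u \<in> {None, Some Ee, Some Ed, Some Ec}"
    by (auto simp: u val_append)
  then have "val ?t v \<in> {None, Some Ee, Some Ed, Some Ec}"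
    using assms(1) by (simp add: ident_def)
  moreover have "prec v p q" if "p \<notin> set v \<or> q \<notin> set v"
    using that unfolding prec_def
    by (metis append_Nil append_Nil2 empty_iff empty_set)
  ultimately show ?thesis
    using test_shape[of p q "{}" v] assms(2) by auto
qed

lemma ident_prec_upto:
  assumes "ident u v" "p \<noteq> q" "p \<noteq> z" "q \<noteq> z" "prec_upto u {z} p q"
  shows "prec_upto v {z} p q"
proof -
  let ?t = "test p q {z}"
  obtain u1 u2 u3 where u: "u = u1 @ u2 @ z # u3" "z \<notin> set u1" "z \<notin> set u2" "z \<notin> set u3"
    "q \<notin> set u1" "q \<notin> set u3" "p \<notin> set u2"
    using assms(5) by (auto simp: prec_upto_def)
  have "val ?t u1 = None \<or> val ?t u1 = Some Ee" "val ?t u3 = None \<or> val ?t u3 = Some Ee"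
    by (rule val_in_pair; use u in \<open>auto simp: test_def\<close>)+
  moreover have "val ?t u2 = None \<or> val ?t u2 = Some Ed"
    by (rule val_in_pair) (use u in \<open>auto simp: test_def\<close>)
  moreover have "?t z = Some Eb" by (simp add: test_def)
  ultimately have "val ?t u \<in> {Some Ea, Some Eb}"
    by (auto simp: u val_append)
  then have "val ?t v \<in> {Some Ea, Some Eb}"
    using assms(1) by (simp add: ident_def)
  then show ?thesis
    using test_shape[of p q "{z}" v] assms(2-4) by (auto intro: upto0_imp)
qed

lemma val_count:
  "val (\<lambda>l. if l = z then Some Eb else None) w =
    (if count_list w z = 0 then None else if count_list w z = 1 then Some Eb else Some Zero)"
  by (induction w) (auto split: if_splits)

lemma ident_linear: "ident u v \<Longrightarrow> count_list u z = 1 \<longleftrightarrow> count_list v z = 1"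
  using val_count[of z u] val_count[of z v] unfolding ident_def
  by (metis elt.distinct option.distinct(1) option.inject zero_neq_one)

lemma ident_set: "ident u v \<Longrightarrow> set u = set v"
proof -
  assume "ident u v"
  then have "count_list u z = 0 \<longleftrightarrow> count_list v z = 0" for z
    using val_count[of z u] val_count[of z v] unfolding ident_def
    by (metis option.distinct(1))
  then show ?thesis by (auto simp: count_list_0_iff)
qed

section \<open>Rewriting inside a block\<close>

text \<open>The word \<open>w\<close> with each letter squared.\<close>

abbreviation dbl :: "'v list \<Rightarrow> 'v list" where
  "dbl w \<equiv> concat (map (\<lambda>a. [a, a]) w)"

lemma deriv_ctxI: "deriv u v \<Longrightarrow> x = p @ u @ q \<Longrightarrow> y = p @ v @ q \<Longrightarrow> deriv x y"
  by (simp add: deriv.ctx)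

text \<open>A letter with a further occurrence anywhere in the word may be doubled. This makes the families with squares
  applicable to letters that are not linear.\<close>

lemma deriv_double:
  assumes "a \<in> set P \<union> set Q"
  shows "deriv (P @ [a] @ Q) (P @ [a, a] @ Q)"
proof (cases "a \<in> set P")
  case True
  then obtain P1 P2 where P: "P = P1 @ a # P2" by (auto dest: split_list)
  have "deriv ([a] @ P2 @ [a]) ([a] @ P2 @ [a, a])"
  proof (cases "P2 = []")
    case True
    then show ?thesis using deriv_sq[of "[a]" "[a]"] by simp
  next
    case False
    then show ?thesis
      using deriv.trans[OF deriv_left[of "[a]" P2] deriv_left'[of "[a]" P2]] by simp
  qed
  then show ?thesis by (rule deriv_ctxI[of _ _ _ P1 Q]) (simp_all add: P)
next
  case False
  then obtain Q1 Q2 where Q: "Q = Q1 @ a # Q2" using assms by (auto dest: split_list)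
  have "deriv ([a] @ Q1 @ [a]) ([a, a] @ Q1 @ [a])"
  proof (cases "Q1 = []")
    case True
    then show ?thesis using deriv_sq[of "[a]" "[a]"] by simp
  next
    case False
    then show ?thesis using deriv_left[of "[a]" Q1] by simp
  qed
  then show ?thesis by (rule deriv_ctxI[of _ _ _ P Q2]) (simp_all add: Q)
qed

lemma deriv_dbl:
  assumes "\<forall>a\<in>set b. 2 \<le> count_list (P @ b @ Q) a"
  shows "deriv (P @ b @ Q) (P @ dbl b @ Q)"
  using assms
proof (induction b arbitrary: P)
  case Nil
  show ?case by (simp add: deriv.refl)
next
  case (Cons a b)
  have "a \<in> set P \<union> set (b @ Q)"
  proof (rule ccontr)
    assume "a \<notin> set P \<union> set (b @ Q)"
    then have "count_list (P @ (a # b) @ Q) a = 1" by (simp add: count_list_0_iff)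
    then show False using Cons.prems by simp
  qed
  then have "deriv (P @ (a # b) @ Q) ((P @ [a, a]) @ b @ Q)"
    using deriv_double[of a P "b @ Q"] by simp
  also have "deriv \<dots> ((P @ [a, a]) @ dbl b @ Q)"
    by (rule Cons.IH) (use Cons.prems in force)
  finally show ?case by simp
qed

lemma deriv_saturate_letter:
  assumes "ys \<noteq> []"
  shows "deriv ([a] @ dbl ys @ [a]) ([a] @ concat (map (\<lambda>y. [y, y, a]) ys))"
proof (cases "length ys \<ge> 2")
  case True
  then show ?thesis
    using deriv_saturate[of "[a]" "[a]" "[a]" "map (\<lambda>y. [y]) ys"] by (simp add: comp_def)
next
  case False
  then obtain y where "ys = [y]" using assms by (cases ys; cases "tl ys") auto
  then show ?thesis by (simp add: deriv.refl)
qed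

text \<open>Between two occurrences of \<open>a\<close>, with no linear letter in between, further occurrences of \<open>a\<close> may be inserted:
  after the letters in between have been squared, both words become the saturated word, with an \<open>a\<close> after every square.\<close>

lemma deriv_insert_between:
  assumes nonlin: "\<forall>l\<in>set (u @ v). 2 \<le> count_list (P @ [a] @ u @ v @ [a] @ Q) l"
  shows "deriv (P @ [a] @ u @ v @ [a] @ Q) (P @ [a] @ u @ [a] @ v @ [a] @ Q)"
proof -
  let ?s = "\<lambda>w. concat (map (\<lambda>y. [y, y, a]) w)"
  consider "u = []" | "v = []" | "u \<noteq> []" "v \<noteq> []" by blast
  then show ?thesis
  proof cases
    case 1
    then show ?thesis using deriv_double[of a P "v @ [a] @ Q"] by simp
  next
    case 2
    then show ?thesis using deriv_double[of a "P @ [a] @ u" Q] by simp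
  next
    case 3
    have "deriv (P @ [a] @ u @ v @ [a] @ Q) (P @ [a] @ dbl (u @ v) @ [a] @ Q)"
      using deriv_dbl[of "u @ v" "P @ [a]" "[a] @ Q"] nonlin by simp
    also have "deriv \<dots> (P @ [a] @ ?s (u @ v) @ Q)"
      by (rule deriv_ctxI[OF deriv_saturate_letter[of "u @ v" a], of _ P Q]) (use 3 in simp_all)
    finally have 1: "deriv (P @ [a] @ u @ v @ [a] @ Q) (P @ [a] @ ?s (u @ v) @ Q)" .
    have "deriv (P @ [a] @ u @ [a] @ v @ [a] @ Q) (P @ [a] @ dbl u @ [a] @ v @ [a] @ Q)"
    proof -
      have "\<forall>l\<in>set u. 2 \<le> count_list ((P @ [a]) @ u @ [a] @ v @ [a] @ Q) l"
        using nonlin by force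
      then show ?thesis
        using deriv_dbl[of u "P @ [a]" "[a] @ v @ [a] @ Q"] by simp
    qed
    also have "deriv \<dots> (P @ [a] @ ?s u @ v @ [a] @ Q)"
      by (rule deriv_ctxI[OF deriv_saturate_letter[of u a], of _ P "v @ [a] @ Q"]) (use 3 in simp_all)
    also have "deriv \<dots> (P @ [a] @ ?s u @ dbl v @ [a] @ Q)"
    proof -
      have c: "count_list (?s u) l = 2 * count_list u l + (if l = a then length u else 0)" for l
        by (induction u) auto
      have "\<forall>l\<in>set v. 2 \<le> count_list ((P @ [a] @ ?s u) @ v @ [a] @ Q) l"
      proof
        fix l assume "l \<in> set v"
        then have "2 \<le> count_list (P @ [a] @ u @ v @ [a] @ Q) l" using nonlin by simp
        then show "2 \<le> count_list ((P @ [a] @ ?s u) @ v @ [a] @ Q) l" by (auto simp: c split: if_splits)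
      qed
      then show ?thesis
        using deriv_dbl[of v "P @ [a] @ ?s u" "[a] @ Q"] by simp
    qed
    also have "deriv \<dots> (P @ [a] @ ?s u @ ?s v @ Q)"
    proof -
      obtain u1 y where u: "u = u1 @ [y]" using 3 by (metis rev_exhaust)
      show ?thesis
        by (rule deriv_ctxI[OF deriv_saturate_letter[of v a], of _ "P @ [a] @ ?s u1 @ [y, y]" Q]) (use 3 u in simp_all)
    qed
    finally have 2: "deriv (P @ [a] @ u @ [a] @ v @ [a] @ Q) (P @ [a] @ ?s (u @ v) @ Q)" by simp
    show ?thesis by (rule deriv.trans[OF 1 deriv.sym[OF 2]])
  qed
qed

text \<open>The word \<open>w\<close>, as a factor of \<open>PwQ\<close>, contains no linear letter of \<open>PwQ\<close>.\<close>

definition nonlin :: "'v list \<Rightarrow> 'v list \<Rightarrow> 'v list \<Rightarrow> bool" where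
  "nonlin P w Q \<longleftrightarrow> (\<forall>l\<in>set w. 2 \<le> count_list (P @ w @ Q) l)"

lemma nonlin_insert: "nonlin P (c @ d) Q \<Longrightarrow> set e \<subseteq> set (c @ d) \<Longrightarrow> nonlin P (c @ e @ d) Q"
proof -
  assume a: "nonlin P (c @ d) Q" "set e \<subseteq> set (c @ d)"
  have "count_list (P @ (c @ d) @ Q) l \<le> count_list (P @ (c @ e @ d) @ Q) l" for l
    by simp
  then show ?thesis
    using a unfolding nonlin_def by (metis (no_types, opaque_lifting) Un_iff order.trans set_append subsetD)
qed

lemma deriv_insert:
  assumes "nonlin P (c @ d) Q" "a \<in> set c" "a \<in> set d"
  shows "deriv (P @ c @ d @ Q) (P @ c @ [a] @ d @ Q)"
proof -
  obtain c1 c2 d1 d2 where c: "c = c1 @ a # c2" "d = d1 @ a # d2"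
    using assms(2,3) by (metis split_list)
  show ?thesis
    using deriv_insert_between[of c2 d1 "P @ c1" a "d2 @ Q"] assms(1) unfolding c nonlin_def by force
qed

lemma deriv_band: "deriv (P @ c @ [p, q, p, q] @ d @ Q) (P @ c @ [q, p, q, p] @ d @ Q)"
proof -
  have "deriv [p, q, p, q] [q, p, q, p]"
    using deriv.trans[OF deriv_band2[of "[p]" "[q]"] deriv.trans[OF deriv_band3[of "[p]" "[q]"] deriv_band4[of "[p]" "[q]"]]]
    by simp
  then show ?thesis by (rule deriv_ctxI[of _ _ _ "P @ c" "d @ Q"]) simp_all
qed

text \<open>The following three lemmas bring a neighbouring pair of letters into the form \<open>pqpq\<close>, which may be exchanged
  with \<open>qpqp\<close>. They serve for two letters that both recur later in the block, for two that both occurred earlier,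
  and for a pair \<open>qp\<close> such that \<open>p\<close> occurred earlier and \<open>q\<close> recurs later.\<close>

lemma deriv_expand_right:
  assumes "nonlin P (c @ [p, q] @ d) Q" "p \<in> set d" "q \<in> set d"
  shows "deriv (P @ c @ [p, q] @ d @ Q) (P @ c @ [p, q, p, q] @ d @ Q)"
proof -
  have "deriv (P @ c @ [p, q] @ d @ Q) (P @ (c @ [p, q, p]) @ d @ Q)"
    using deriv_insert[of P "c @ [p, q]" d Q p] assms by simp
  also have "deriv \<dots> (P @ (c @ [p, q, p]) @ [q] @ d @ Q)"
    by (rule deriv_insert) (use assms nonlin_insert[of P "c @ [p, q]" d Q "[p]"] in simp_all)
  finally show ?thesis by simp
qed

lemma deriv_expand_left:
  assumes "nonlin P (c @ [p, q] @ d) Q" "p \<in> set c" "q \<in> set c"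
  shows "deriv (P @ c @ [p, q] @ d @ Q) (P @ c @ [p, q, p, q] @ d @ Q)"
proof -
  have "deriv (P @ c @ [p, q] @ d @ Q) (P @ c @ ([q, p, q] @ d) @ Q)"
    using deriv_insert[of P c "[p, q] @ d" Q q] assms by simp
  also have "deriv \<dots> (P @ c @ [p] @ ([q, p, q] @ d) @ Q)"
    by (rule deriv_insert) (use assms nonlin_insert[of P c "[p, q] @ d" Q "[q]"] in simp_all)
  finally show ?thesis by simp
qed

lemma deriv_expand_mid:
  assumes "nonlin P (c @ [q, p] @ d) Q" "p \<in> set c" "q \<in> set d"
  shows "deriv (P @ c @ [q, p] @ d @ Q) (P @ c @ [p, q, p, q] @ d @ Q)"
proof -
  have "deriv (P @ c @ [q, p] @ d @ Q) (P @ (c @ [p, q, p]) @ d @ Q)"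
    using deriv_insert[of P c "[q, p] @ d" Q p] assms by simp
  also have "deriv \<dots> (P @ (c @ [p, q, p]) @ [q] @ d @ Q)"
    by (rule deriv_insert) (use assms nonlin_insert[of P c "[q, p] @ d" Q "[p]"] in simp_all)
  finally show ?thesis by simp
qed

lemma deriv_swap_of_expand:
  assumes "deriv (P @ c @ [p, q] @ d @ Q) (P @ c @ [p, q, p, q] @ d @ Q)"
    "deriv (P @ c @ [q, p] @ d @ Q) (P @ c @ [q, p, q, p] @ d @ Q)"
  shows "deriv (P @ c @ [p, q] @ d @ Q) (P @ c @ [q, p] @ d @ Q)"
  by (rule deriv.trans[OF assms(1) deriv.trans[OF deriv_band deriv.sym[OF assms(2)]]])

lemma nonlin_commute: "nonlin P (c @ [q, p] @ d) Q \<Longrightarrow> nonlin P (c @ [p, q] @ d) Q"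
  unfolding nonlin_def by (auto split: if_splits)

lemma deriv_swap_starts:
  assumes "nonlin P (c @ [p, q] @ d) Q" "p \<in> set d" "q \<in> set d"
  shows "deriv (P @ c @ [p, q] @ d @ Q) (P @ c @ [q, p] @ d @ Q)"
  by (rule deriv_swap_of_expand; rule deriv_expand_right) (use assms nonlin_commute in auto)

lemma deriv_swap_ends:
  assumes "nonlin P (c @ [p, q] @ d) Q" "p \<in> set c" "q \<in> set c"
  shows "deriv (P @ c @ [p, q] @ d @ Q) (P @ c @ [q, p] @ d @ Q)"
  by (rule deriv_swap_of_expand; rule deriv_expand_left) (use assms nonlin_commute in auto)

text \<open>Some \<open>p\<close> in \<open>Q\<close> has a \<open>q\<close> further to the right or in the same block of \<open>Q\<close>; the set \<open>N\<close> stands for the letters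
  that are not linear. This is what the identities \<open>xytxsy \<approx> (xy)\<^sup>2txsy\<close> and
  \<open>xytxz\<^sub>1\<^sup>2\<dots>z\<^sub>n\<^sup>2y \<approx> yxtxz\<^sub>1\<^sup>2\<dots>z\<^sub>n\<^sup>2y\<close> need.\<close>

definition after :: "'v set \<Rightarrow> 'v list \<Rightarrow> 'v \<Rightarrow> 'v \<Rightarrow> bool" where
  "after N Q p q \<longleftrightarrow> (\<exists>Q1 Q2 Q3. Q = Q1 @ [p] @ Q2 @ [q] @ Q3) \<or>
     (\<exists>Q1 W Q2. Q = Q1 @ [q] @ W @ [p] @ Q2 \<and> set W \<subseteq> N)"

lemma deriv_swap_after:
  assumes nonlin: "nonlin P (c @ [p, q] @ d) Q" and pq: "p \<in> set c" "q \<in> set d"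
    and N: "\<forall>l\<in>N. 2 \<le> count_list (P @ c @ [p, q] @ d @ Q) l"
    and af: "after N Q p q"
  shows "deriv (P @ c @ [p, q] @ d @ Q) (P @ c @ [q, p] @ d @ Q)"
proof -
  have dne: "d \<noteq> []" using pq by auto
  consider (sub) Q1 Q2 Q3 where "Q = Q1 @ [p] @ Q2 @ [q] @ Q3" "Q2 \<noteq> []"
    | (adj) Q1 Q3 where "Q = Q1 @ [p] @ [q] @ Q3"
    | (rev) Q1 W Q2 where "Q = Q1 @ [q] @ W @ [p] @ Q2" "set W \<subseteq> N"
    using af unfolding after_def by fastforce
  then show ?thesis
  proof cases
    case sub
    have "deriv (P @ c @ [p, q] @ d @ Q) (P @ c @ [p, q, p, q] @ d @ Q)"
      by (rule deriv_ctxI[OF deriv_first[of "[p]" "[q]" "d @ Q1" Q2], of _ "P @ c" Q3])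
        (use dne sub in simp_all)
    also have "deriv \<dots> (P @ c @ [q, p] @ d @ Q)"
      by (rule deriv.sym, rule deriv_expand_mid) (use nonlin nonlin_commute pq in auto)
    finally show ?thesis .
  next
    case adj
    show ?thesis
      by (rule deriv_ctxI[OF deriv_swap[of "[p]" "[q]" "d @ Q1" "[]"], of _ "P @ c" Q3])
        (use dne adj in simp_all)
  next
    case rev
    let ?Q = "Q1 @ [q] @ dbl W @ [p] @ Q2"
    have "deriv (P @ c @ [p, q] @ d @ Q) (P @ c @ [p, q] @ d @ ?Q)"
      using deriv_dbl[of W "P @ c @ [p, q] @ d @ Q1 @ [q]" "[p] @ Q2"] N rev by auto
    also have "deriv \<dots> (P @ c @ [q, p] @ d @ ?Q)"
      by (rule deriv_ctxI[OF deriv.sym[OF deriv_swap[of "[q]" "[p]" "d @ Q1" "map (\<lambda>a. [a]) W"]], of _ "P @ c" Q2])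
        (use dne rev in \<open>simp_all add: comp_def\<close>)
    also have "deriv \<dots> (P @ c @ [q, p] @ d @ Q)"
    proof (rule deriv.sym)
      have "count_list (P @ c @ [p, q] @ d @ Q) l = count_list (P @ c @ [q, p] @ d @ Q) l" for l by simp
      then show "deriv (P @ c @ [q, p] @ d @ Q) (P @ c @ [q, p] @ d @ ?Q)"
        using deriv_dbl[of W "P @ c @ [q, p] @ d @ Q1 @ [q]" "[p] @ Q2"] N rev by auto
    qed
    finally show ?thesis .
  qed
qed

lemma nonlin_rev: "nonlin P w Q \<Longrightarrow> nonlin (rev Q) (rev w) (rev P)"
  by (auto simp: nonlin_def ac_simps)

text \<open>The exchange that applies to a last occurrence of \<open>p\<close> next to a first occurrence of \<open>q\<close>, where other occurrences of
  \<open>p\<close> and \<open>q\<close> lie in \<open>c\<close> and \<open>d\<close>. If \<open>q\<close> occurs in \<open>P\<close> and \<open>p\<close> in \<open>Q\<close>, it is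
  justified by \<open>xt(yx)\<^sup>2sy \<approx> xtyxsy\<close>; the remaining cases are \<open>deriv_swap_after\<close> and its mirror image.\<close>

lemma deriv_swap_end_start:
  assumes nonlin: "nonlin P (c @ [p, q] @ d) Q" and pq: "p \<in> set c" "q \<in> set d"
    and N: "\<forall>l\<in>N. 2 \<le> count_list (P @ c @ [p, q] @ d @ Q) l"
    and A: "q \<in> set P \<or> after N Q p q" and B: "p \<in> set Q \<or> after N (rev P) q p"
  shows "deriv (P @ c @ [p, q] @ d @ Q) (P @ c @ [q, p] @ d @ Q)"
proof -
  consider "after N Q p q" | "after N (rev P) q p" | "q \<in> set P" "p \<in> set Q"
    using A B by blast
  then show ?thesis
  proof cases
    case 1
    then show ?thesis using deriv_swap_after[OF nonlin pq N] by blast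
  next
    case 2
    have "deriv (rev Q @ rev d @ [q, p] @ rev c @ rev P) (rev Q @ rev d @ [p, q] @ rev c @ rev P)"
      by (rule deriv_swap_after[where N = N]) (use nonlin_rev[OF nonlin] pq N 2 in \<open>auto simp: ac_simps\<close>)
    then show ?thesis
      by (subst deriv_rev_iff[symmetric]) simp
  next
    case 3
    then obtain P1 P2 Q1 Q2 where PQ: "P = P1 @ q # P2" "Q = Q1 @ p # Q2"
      by (metis split_list)
    have "deriv (P @ c @ [p, q] @ d @ Q) (P @ c @ [p, q, p, q] @ d @ Q)"
      by (rule deriv_ctxI[OF deriv.sym[OF deriv_middle[of "[q]" "[p]" "P2 @ c" "d @ Q1"]], of _ P1 Q2])
        (use pq PQ in auto)
    also have "deriv \<dots> (P @ c @ [q, p] @ d @ Q)"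
      by (rule deriv.sym, rule deriv_expand_mid) (use nonlin nonlin_commute pq in auto)
    finally show ?thesis .
  qed
qed

section \<open>Arrangements of first and last occurrences\<close>

text \<open>Some occurrence of \<open>x\<close> in the list is to the left of some occurrence of \<open>y\<close>; used for lists without repetitions.\<close>

fun before :: "'e list \<Rightarrow> 'e \<Rightarrow> 'e \<Rightarrow> bool" where
  "before [] x y \<longleftrightarrow> False"
| "before (e # l) x y \<longleftrightarrow> (e = x \<and> y \<in> set l) \<or> before l x y"

lemma before_append: "before (l @ m) x y \<longleftrightarrow> before l x y \<or> (x \<in> set l \<and> y \<in> set m) \<or> before m x y"
  by (induction l) auto

lemma before_set: "before l x y \<Longrightarrow> x \<in> set l \<and> y \<in> set l"
  by (induction l) auto

lemma before_split: "before l x y \<Longrightarrow> \<exists>l1 l2. l = l1 @ l2 \<and> x \<in> set l1 \<and> y \<in> set l2"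
proof (induction l)
  case (Cons e l)
  show ?case
  proof (cases "e = x \<and> y \<in> set l")
    case True
    then show ?thesis by (intro exI[of _ "[e]"] exI[of _ l]) simp
  next
    case False
    then obtain l1 l2 where "l = l1 @ l2" "x \<in> set l1" "y \<in> set l2" using Cons by auto
    then show ?thesis by (intro exI[of _ "e # l1"] exI[of _ l2]) simp
  qed
qed simp

lemma before_asym: "distinct l \<Longrightarrow> before l x y \<Longrightarrow> \<not> before l y x"
  by (induction l) (auto dest: before_set)

text \<open>Here \<open>W\<close> is the set of lists in which exchanges are permitted, and \<open>D\<close> the equivalence to be established.\<close>

lemma move_to_front:
  assumes swap: "\<And>c x y d. W (c @ x # y # d) \<Longrightarrow> indep x y \<Longrightarrow> W (c @ y # x # d) \<and> D (c @ x # y # d) (c @ y # x # d)"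
    and refl: "\<And>l. D l l" and trans: "\<And>k l m. D k l \<Longrightarrow> D l m \<Longrightarrow> D k m"
    and "W (c @ u @ x # v)" "\<forall>y\<in>set u. indep y x"
  shows "W (c @ x # u @ v) \<and> D (c @ u @ x # v) (c @ x # u @ v)"
  using assms(4,5)
proof (induction u arbitrary: v rule: rev_induct)
  case Nil
  then show ?case using refl by simp
next
  case (snoc y u)
  have 1: "W ((c @ u) @ x # y # v) \<and> D ((c @ u) @ y # x # v) ((c @ u) @ x # y # v)"
    using swap[of "c @ u" y x v] snoc.prems by simp
  then have "W (c @ x # u @ (y # v)) \<and> D (c @ u @ x # y # v) (c @ x # u @ (y # v))"
    using snoc.IH[of "y # v"] snoc.prems by simp
  then show ?case using 1 trans by force
qed

text \<open>Two listings of the same elements, of which every two in different order are independent, are connected by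
  exchanges of neighbouring independent elements: the first element of one list is moved to the front of the other.\<close>

lemma trace_equiv:
  assumes swap: "\<And>c x y d. W (c @ x # y # d) \<Longrightarrow> indep x y \<Longrightarrow> W (c @ y # x # d) \<and> D (c @ x # y # d) (c @ y # x # d)"
    and refl: "\<And>l. D l l" and trans: "\<And>k l m. D k l \<Longrightarrow> D l m \<Longrightarrow> D k m"
    and "W (c @ m')" "distinct m" "distinct m'" "set m = set m'"
    and "\<And>x y. before m x y \<Longrightarrow> before m' y x \<Longrightarrow> indep y x"
  shows "D (c @ m') (c @ m)"
  using assms(4-)
proof (induction m arbitrary: c m')
  case Nil
  then show ?case using refl by simp
next
  case (Cons x m)
  then obtain u v where m': "m' = u @ x # v" by (metis list.set_intros(1) split_list)
  have u: "\<forall>y\<in>set u. indep y x"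
  proof
    fix y assume y: "y \<in> set u"
    then have "y \<in> set (x # m)" "y \<noteq> x" using Cons.prems(3,4) m' by auto
    then have "y \<in> set m" by simp
    then show "indep y x" using Cons.prems(5)[of x y] y m' by (simp add: before_append)
  qed
  have 1: "W (c @ x # u @ v) \<and> D (c @ u @ x # v) (c @ x # u @ v)"
    by (rule move_to_front[where W = W and indep = indep and D = D, OF swap refl trans]) (use Cons.prems(1) m' u in auto)
  have "D ((c @ [x]) @ u @ v) ((c @ [x]) @ m)"
  proof (rule Cons.IH)
    show "indep b a" if "before m a b" "before (u @ v) b a" for a b
      using that Cons.prems(5)[of a b] m' by (auto simp: before_append)
    show "set m = set (u @ v)"
      using Cons.prems(2-4) m' by auto
  qed (use 1 Cons.prems m' in auto)
  then show ?case using 1 trans m' by force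
qed

text \<open>\<open>Start a\<close> and \<open>End a\<close> stand for the first and the last occurrence of the letter \<open>a\<close> in a block.\<close>

datatype 'v endpoint = Start 'v | End 'v

fun letter_of :: "'v endpoint \<Rightarrow> 'v" where
  "letter_of (Start a) = a"
| "letter_of (End a) = a"

text \<open>Listings of the endpoints of the letters in \<open>A\<close> with each letter starting before it ends. Read as words, they
  contain every letter of \<open>A\<close> exactly twice.\<close>

definition arrangement :: "'v set \<Rightarrow> 'v endpoint list \<Rightarrow> bool" where
  "arrangement A l \<longleftrightarrow> distinct l \<and> set l = Start ` A \<union> End ` A \<and> (\<forall>a\<in>A. before l (Start a) (End a))"

lemma arrangement_letters: "arrangement A l \<Longrightarrow> set (map letter_of l) = A"
  by (force simp: arrangement_def)

lemma arrangement_count: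
  assumes "arrangement A l" "a \<in> A"
  shows "2 \<le> count_list (map letter_of l) a"
proof -
  have "before l (Start a) (End a)" using assms by (simp add: arrangement_def)
  then obtain l1 l2 where l: "l = l1 @ l2" "Start a \<in> set l1" "End a \<in> set l2"
    using before_split by metis
  then have "a \<in> set (map letter_of l1)" "a \<in> set (map letter_of l2)" by force+
  then have "count_list (map letter_of l1) a \<noteq> 0" "count_list (map letter_of l2) a \<noteq> 0"
    unfolding count_list_0_iff by blast+
  then show ?thesis by (simp add: l)
qed

lemma arrangement_nl: "arrangement A l \<Longrightarrow> nonlin P (map letter_of l) Q"
  using arrangement_count[of A l] arrangement_letters[of A l] unfolding nonlin_def
  by (metis add.commute count_list_append trans_le_add1)

lemma prec_snoc: "prec (b @ [a]) p q \<longleftrightarrow> prec b p q \<and> a \<noteq> p \<or> q \<notin> set (b @ [a])"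
proof
  assume "prec (b @ [a]) p q"
  then obtain w1 w2 where w: "b @ [a] = w1 @ w2" "q \<notin> set w1" "p \<notin> set w2"
    by (auto simp: prec_def)
  show "prec b p q \<and> a \<noteq> p \<or> q \<notin> set (b @ [a])"
  proof (cases w2 rule: rev_cases)
    case (snoc w z)
    then show ?thesis using w by (auto simp: prec_def)
  qed (use w in auto)
next
  assume "prec b p q \<and> a \<noteq> p \<or> q \<notin> set (b @ [a])"
  then show "prec (b @ [a]) p q"
  proof
    assume h: "prec b p q \<and> a \<noteq> p"
    then obtain w1 w2 where "b = w1 @ w2" "q \<notin> set w1" "p \<notin> set w2" by (auto simp: prec_def)
    then show ?thesis using h unfolding prec_def by (intro exI[of _ w1] exI[of _ "w2 @ [a]"]) auto
  next
    assume "q \<notin> set (b @ [a])"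
    then show ?thesis unfolding prec_def by (intro exI[of _ "b @ [a]"] exI[of _ "[]"]) auto
  qed
qed

text \<open>A block can be rewritten so that each of its letters occurs exactly twice, with the order of last occurrences
  relative to first occurrences of other letters unchanged.\<close>

lemma deriv_arrangement:
  assumes "nonlin P b Q"
  obtains l where "arrangement (set b) l" "deriv (P @ b @ Q) (P @ map letter_of l @ Q)"
    "\<And>p q. p \<in> set b \<Longrightarrow> q \<in> set b \<Longrightarrow> p \<noteq> q \<Longrightarrow> before l (End p) (Start q) \<longleftrightarrow> prec b p q"
proof -
  have "\<exists>l. arrangement (set b) l \<and> deriv (P @ b @ Q) (P @ map letter_of l @ Q) \<and>
    (\<forall>p\<in>set b. \<forall>q\<in>set b. p \<noteq> q \<longrightarrow> (before l (End p) (Start q) \<longleftrightarrow> prec b p q))"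
    using assms
  proof (induction b arbitrary: Q rule: rev_induct)
    case Nil
    show ?case
      by (intro exI[of _ "[]"]) (simp add: arrangement_def deriv.refl)
  next
    case (snoc a b)
    have nlb: "nonlin P b (a # Q)" using snoc.prems by (auto simp: nonlin_def)
    obtain l where l: "arrangement (set b) l" "deriv (P @ b @ a # Q) (P @ map letter_of l @ a # Q)"
      and ord: "\<And>p q. p \<in> set b \<Longrightarrow> q \<in> set b \<Longrightarrow> p \<noteq> q \<Longrightarrow> before l (End p) (Start q) \<longleftrightarrow> prec b p q"
      using snoc.IH[OF nlb] by auto
    show ?case
    proof (cases "a \<in> set b")
      case False
      let ?l = "l @ [Start a, End a]"
      have ne: "Start a \<notin> set l" "End a \<notin> set l" using l(1) False by (auto simp: arrangement_def)
      have "arrangement (set (b @ [a])) ?l"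
        using l(1) ne by (auto simp: arrangement_def before_append)
      moreover have "deriv (P @ (b @ [a]) @ Q) (P @ map letter_of ?l @ Q)"
      proof -
        have "a \<in> set P \<union> set Q"
          by (rule ccontr) (use snoc.prems False in \<open>auto simp: nonlin_def count_list_0_iff\<close>)
        then have "a \<in> set (P @ map letter_of l) \<union> set Q" by auto
        then have "deriv ((P @ map letter_of l) @ [a] @ Q) ((P @ map letter_of l) @ [a, a] @ Q)"
          by (rule deriv_double)
        then show ?thesis using deriv.trans[OF l(2)] by simp
      qed
      moreover have "before ?l (End p) (Start q) \<longleftrightarrow> prec (b @ [a]) p q"
        if pq: "p \<in> set (b @ [a])" "q \<in> set (b @ [a])" "p \<noteq> q" for p q
      proof -
        have "prec b p q" if "q = a" using that False unfolding prec_def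
          by (intro exI[of _ b] exI[of _ "[]"]) simp
        moreover have "End p \<in> set l \<longleftrightarrow> p \<in> set b" using l(1) by (auto simp: arrangement_def)
        ultimately show ?thesis
          using pq ne ord[of p q] by (auto simp: prec_snoc before_append dest: before_set)
      qed
      ultimately show ?thesis by blast
    next
      case True
      have "End a \<in> set l" using l(1) True by (auto simp: arrangement_def)
      then obtain l1 l2 where l12: "l = l1 @ End a # l2" by (metis split_list)
      let ?l = "l1 @ l2 @ [End a]"
      have dist: "End a \<notin> set l1" "End a \<notin> set l2" "distinct l"
        using l(1) l12 by (auto simp: arrangement_def)
      have Sa: "before l (Start a) (End a)" using l(1) True by (auto simp: arrangement_def)
      then have Sa1: "Start a \<in> set l1"
        using dist unfolding l12 by (auto simp: before_append dest: before_set)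
      \<comment> \<open>The new occurrence of \<open>a\<close> becomes its last one, and the former last one is dropped.\<close>
      have bl: "before ?l x y \<longleftrightarrow> before l x y" if "x \<noteq> End a" "y \<noteq> End a" for x y
        using that by (auto simp: l12 before_append)
      have arr: "arrangement (set (b @ [a])) ?l"
      proof -
        have "before ?l (Start c) (End c)" if "c \<in> set b" for c
        proof (cases "c = a")
          case True
          then show ?thesis using Sa1 by (simp add: before_append)
        next
          case False
          then show ?thesis using that bl[of "Start c" "End c"] l(1) by (simp add: arrangement_def)
        qed
        moreover have "set ?l = set l" "distinct ?l" using dist by (auto simp: l12)
        ultimately show ?thesis using l(1) True by (auto simp: arrangement_def)
      qed
      moreover have "deriv (P @ (b @ [a]) @ Q) (P @ map letter_of ?l @ Q)"
      proof -
        have "nonlin P (map letter_of l1 @ (map letter_of l2 @ [a])) Q"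
          using arrangement_nl[OF arr, of P Q] by simp
        moreover have "a \<in> set (map letter_of l1)" using Sa1 by force
        ultimately have "deriv (P @ map letter_of l1 @ (map letter_of l2 @ [a]) @ Q) (P @ map letter_of l1 @ [a] @ (map letter_of l2 @ [a]) @ Q)"
          by (intro deriv_insert) simp_all
        then show ?thesis using deriv.trans[OF l(2) deriv.sym] by (simp add: l12)
      qed
      moreover have "before ?l (End p) (Start q) \<longleftrightarrow> prec (b @ [a]) p q"
        if pq: "p \<in> set (b @ [a])" "q \<in> set (b @ [a])" "p \<noteq> q" for p q
      proof (cases "p = a")
        case True
        then show ?thesis using dist pq \<open>a \<in> set b\<close> by (auto simp: prec_snoc before_append dest: before_set)
      next
        case False
        then show ?thesis using pq bl[of "End p" "Start q"] ord[of p q] \<open>a \<in> set b\<close> by (auto simp: prec_snoc)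
      qed
      ultimately show ?thesis by blast
    qed
  qed
  then show ?thesis using that by blast
qed

text \<open>Endpoints that may be exchanged when they are neighbours. \<open>N p q\<close> allows to exchange the end of \<open>p\<close> with the
  start of \<open>q\<close>.\<close>

fun indep :: "('v \<Rightarrow> 'v \<Rightarrow> bool) \<Rightarrow> 'v endpoint \<Rightarrow> 'v endpoint \<Rightarrow> bool" where
  "indep N (Start p) (Start q) = True"
| "indep N (End p) (End q) = True"
| "indep N (End p) (Start q) = (p \<noteq> q \<and> N p q)"
| "indep N (Start q) (End p) = (p \<noteq> q \<and> N p q)"

lemma deriv_of_arrangements:
  assumes swap: "\<And>p q c d. N p q \<Longrightarrow> set (c @ [p, q] @ d) = A \<Longrightarrow> nonlin P (c @ [p, q] @ d) Q \<Longrightarrow>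
      p \<in> set c \<Longrightarrow> q \<in> set d \<Longrightarrow> deriv (P @ c @ [p, q] @ d @ Q) (P @ c @ [q, p] @ d @ Q)"
    and l: "arrangement A l" and l': "arrangement A l'"
    and ord: "\<And>p q. p \<in> A \<Longrightarrow> q \<in> A \<Longrightarrow> p \<noteq> q \<Longrightarrow> \<not> N p q \<Longrightarrow>
      before l (End p) (Start q) \<longleftrightarrow> before l' (End p) (Start q)"
  shows "deriv (P @ map letter_of l @ Q) (P @ map letter_of l' @ Q)"
proof -
  let ?D = "\<lambda>l l'. deriv (P @ map letter_of l @ Q) (P @ map letter_of l' @ Q)"
  have "?D ([] @ l) ([] @ l')"
  proof (rule trace_equiv[where W = "arrangement A" and indep = "indep N" and D = ?D])
    fix c x y d
    assume W: "arrangement A (c @ x # y # d)" and xy: "indep N x y"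
    let ?l = "c @ x # y # d" and ?m = "c @ y # x # d"
    have "before ?m (Start a) (End a)" if "before ?l (Start a) (End a)" for a
      using that xy by (auto simp: before_append)
    then have W': "arrangement A ?m"
      using W unfolding arrangement_def by auto
    let ?c = "map letter_of c" and ?d = "map letter_of d"
    have n: "nonlin P (?c @ [letter_of x, letter_of y] @ ?d) Q" "nonlin P (?c @ [letter_of y, letter_of x] @ ?d) Q"
      using arrangement_nl[OF W, of P Q] arrangement_nl[OF W', of P Q] by simp_all
    have A: "set (?c @ [letter_of x, letter_of y] @ ?d) = A" "set (?c @ [letter_of y, letter_of x] @ ?d) = A"
      using arrangement_letters[OF W] arrangement_letters[OF W'] by simp_all
    have S: "p \<in> set ?d" if "Start p \<in> {x, y}" "End p \<notin> {x, y}" for p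
    proof -
      have "p \<in> A" using that A(1) by auto
      then have "before ?l (Start p) (End p)" using W unfolding arrangement_def by blast
      then have "End p \<in> set d" using that W unfolding arrangement_def
        by (auto simp: before_append dest: before_set)
      then show ?thesis by force
    qed
    have E: "p \<in> set ?c" if "End p \<in> {x, y}" "Start p \<notin> {x, y}" for p
    proof -
      have "p \<in> A" using that A(1) by auto
      then have "before ?l (Start p) (End p)" using W unfolding arrangement_def by blast
      then have "Start p \<in> set c" using that W unfolding arrangement_def
        by (auto simp: before_append dest: before_set)
      then show ?thesis by force
    qed
    have "deriv (P @ ?c @ [letter_of x, letter_of y] @ ?d @ Q) (P @ ?c @ [letter_of y, letter_of x] @ ?d @ Q)"
    proof (cases x)
      case x: (Start p)
      show ?thesis
      proof (cases y)
        case y: (Start q)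
        show ?thesis by (rule deriv_swap_starts) (use n S x y in auto)
      next
        case y: (End q)
        show ?thesis
          by (rule deriv.sym, rule swap) (use n S E A xy x y in auto)
      qed
    next
      case x: (End p)
      show ?thesis
      proof (cases y)
        case y: (Start q)
        show ?thesis
          by (rule swap) (use n S E A xy x y in auto)
      next
        case y: (End q)
        show ?thesis by (rule deriv_swap_ends) (use n E x y in auto)
      qed
    qed
    then show "arrangement A ?m \<and> ?D ?l ?m" using W' by simp
  next
    fix x y assume b: "before l' x y" "before l y x"
    have nb: "\<not> before l' y x" "\<not> before l x y"
      using b l l' before_asym unfolding arrangement_def by metis+
    have in_A: "letter_of x \<in> A" "letter_of y \<in> A"
      using before_set[OF b(1)] arrangement_letters[OF l'] by force+
    have SE: "before l (Start a) (End a)" "before l' (Start a) (End a)" if "a \<in> A" for a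
      using l l' that by (auto simp: arrangement_def)
    show "indep N y x"
    proof (cases x)
      case x: (Start p)
      then show ?thesis
        using b nb in_A ord[of "letter_of y" p] SE(2)[of p] before_asym[of l' x y] l' SE(1)[of p] by (cases y) auto
    next
      case x: (End p)
      then show ?thesis
        using b nb in_A ord[of p "letter_of y"] SE(1)[of p] SE(2)[of p] by (cases y) auto
    qed
  qed (use l l' in \<open>auto simp: arrangement_def intro: deriv.refl deriv.trans\<close>)
  then show ?thesis by simp
qed

section \<open>Every identity is derivable\<close>

text \<open>From here on, a letter \<open>z\<close> is linear in \<open>w\<close> if \<^term>\<open>count_list w z = 1\<close>.\<close>

lemma lin_split: "count_list (a @ z # b) z = 1 \<longleftrightarrow> z \<notin> set a \<and> z \<notin> set b"
  by (auto simp: count_list_0_iff)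

lemma lin_unique:
  assumes "count_list w z = 1" "w = a @ z # b" "w = a' @ z # b'"
  shows "a = a' \<and> b = b'"
proof -
  have "z \<notin> set a" "z \<notin> set b"
    using assms(1) unfolding assms(2) lin_split by auto
  then show ?thesis using assms(2,3) append_Cons_eq_iff[of z a b a' b'] by metis
qed

lemma precI: "q \<notin> set a \<Longrightarrow> p \<notin> set b \<Longrightarrow> prec (a @ b) p q"
  unfolding prec_def by blast

lemma prec_uptoI:
  assumes "w = a @ b @ z # c" "z \<notin> set a" "z \<notin> set b" "z \<notin> set c" "q \<notin> set a" "q \<notin> set c" "p \<notin> set b"
  shows "prec_upto w {z} p q"
  unfolding prec_upto_def
  by (rule exI[of _ a], rule exI[of _ b], rule exI[of _ z], rule exI[of _ c]) (use assms in auto)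

lemma prec_tail:
  assumes "prec (a @ z # r) p z"
  shows "p \<notin> set (z # r)"
proof -
  obtain w1 w2 where w: "a @ z # r = w1 @ w2" "z \<notin> set w1" "p \<notin> set w2"
    using assms by (auto simp: prec_def)
  then obtain k where "(a = w1 @ k \<and> k @ z # r = w2) \<or> (a @ k = w1 \<and> z # r = k @ w2)"
    by (auto simp: append_eq_append_conv2)
  then show ?thesis using w by (cases k) auto
qed

lemma prec_rev: "prec (rev w) q p \<longleftrightarrow> prec w p q"
proof -
  have "prec (rev w) q p" if "prec w p q" for w :: "'a list" and p q
    using that unfolding prec_def by (metis rev_append set_rev)
  from this[of w p q] this[of "rev w" q p] show ?thesis by auto
qed

lemma prec_head:
  assumes "prec (a @ z # r) z q"
  shows "q \<notin> set (a @ [z])"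
  using assms prec_tail[of "rev r" z "rev a" q] prec_rev[of "a @ z # r" q z] by simp

lemma prec_infix:
  assumes "prec (a @ b @ c) p q"
  shows "prec b p q"
proof -
  obtain w1 w2 where w: "a @ b @ c = w1 @ w2" "q \<notin> set w1" "p \<notin> set w2"
    using assms by (auto simp: prec_def)
  then obtain k where "(a = w1 @ k \<and> k @ b @ c = w2) \<or> (a @ k = w1 \<and> b @ c = k @ w2)"
    by (auto simp: append_eq_append_conv2)
  then show ?thesis
  proof
    assume "a = w1 @ k \<and> k @ b @ c = w2"
    then show ?thesis using w precI[of q "[]" p b] by auto
  next
    assume k: "a @ k = w1 \<and> b @ c = k @ w2"
    then obtain m where "(b = k @ m \<and> m @ c = w2) \<or> (b @ m = k \<and> c = m @ w2)"
      by (auto simp: append_eq_append_conv2)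
    then show ?thesis using w k precI[of q k p m] precI[of q b p "[]"] by auto
  qed
qed

text \<open>For letters \<open>p\<close> and \<open>q\<close> of a block \<open>B\<close> in a word \<open>PBQ\<close>: no \<open>q\<close> occurs in \<open>P\<close>, and either no \<open>p\<close> occurs in \<open>Q\<close> or
  some linear letter of \<open>Q\<close> has no \<open>p\<close> of \<open>Q\<close> before it and no \<open>q\<close> after it. Then \<open>A\<^sup>1\<close> tells whether all \<open>p\<close> precede
  all \<open>q\<close> in \<open>B\<close>, by the test for this linear letter. Reversing the word and swapping \<open>p\<close> and \<open>q\<close> gives the
  condition for \<open>B\<^sup>1\<close>.\<close>

definition determined :: "('v \<Rightarrow> bool) \<Rightarrow> 'v list \<Rightarrow> 'v list \<Rightarrow> 'v \<Rightarrow> 'v \<Rightarrow> bool" where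
  "determined lin P Q p q \<longleftrightarrow> q \<notin> set P \<and>
     (p \<notin> set Q \<or> (\<exists>Q1 z Q2. Q = Q1 @ z # Q2 \<and> lin z \<and> p \<notin> set Q1 \<and> q \<notin> set Q2))"

text \<open>The link between the two sides of the proof: a pair that is not determined has the occurrences outside the
  block that the exchanges need on one side; the other side is obtained from the reversed word.\<close>

lemma after_if_not_determined:
  assumes nd: "\<not> determined lin P Q p q" and N: "\<And>l. l \<in> set Q \<Longrightarrow> \<not> lin l \<Longrightarrow> l \<in> N"
    and hd: "Q \<noteq> [] \<Longrightarrow> lin (hd Q)" and pq: "\<not> lin p" "\<not> lin q" "p \<noteq> q"
  shows "q \<in> set P \<or> after N Q p q"
proof (rule ccontr)
  assume "\<not> (q \<in> set P \<or> after N Q p q)"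
  then have q: "q \<notin> set P" and na: "\<not> after N Q p q" by auto
  have "p \<in> set Q" using nd q by (auto simp: determined_def)
  then obtain Q1 Q2 where Q: "Q = Q1 @ p # Q2" "p \<notin> set Q1" by (metis split_list_first)
  have q2: "q \<notin> set Q2"
  proof
    assume "q \<in> set Q2"
    then obtain Q3 Q4 where "Q2 = Q3 @ q # Q4" by (metis split_list)
    then have "Q = Q1 @ [p] @ Q3 @ [q] @ Q4" using Q by simp
    then show False using na unfolding after_def by blast
  qed
  show False
  proof (cases "q \<in> set Q1")
    case True
    then obtain Q0 W where W: "Q1 = Q0 @ q # W" "q \<notin> set W" by (metis split_list_last)
    have "Q = Q0 @ [q] @ W @ [p] @ Q2" using Q W by simp
    then have "\<not> set W \<subseteq> N" using na unfolding after_def by blast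
    then obtain z where "z \<in> set W" "lin z" using N Q W by auto
    then obtain W1 W2 where z: "W = W1 @ z # W2" by (metis split_list)
    have "Q = (Q0 @ q # W1) @ z # (W2 @ p # Q2)" using Q W z by simp
    moreover have "p \<notin> set (Q0 @ q # W1)" "q \<notin> set (W2 @ p # Q2)"
      using Q W z q2 pq by auto
    ultimately have "determined lin P Q p q" unfolding determined_def using q \<open>lin z\<close> by blast
    then show False using nd by blast
  next
    case False
    have "Q \<noteq> []" using Q by simp
    then obtain z R where z: "Q = z # R" by (cases Q) auto
    then have "lin z" using hd by simp
    moreover have "q \<notin> set R" using z Q False q2 pq by (cases Q1) auto
    ultimately have "determined lin P Q p q"
      unfolding determined_def using z q by (metis append_Nil empty_iff empty_set)
    then show False using nd by blast
  qed
qed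

text \<open>An identity preserves the order of a determined pair inside the block.\<close>

lemma ident_prec_of_determined:
  assumes id: "ident u v" and u: "u = P @ B @ Q" and v: "v = P' @ B' @ Q'"
    and determined: "determined (\<lambda>z. count_list u z = 1) P Q p q" and B: "prec B p q"
    and pq: "p \<noteq> q" "count_list u p \<noteq> 1" "count_list u q \<noteq> 1"
    and Q': "\<And>z. z \<in> set Q \<Longrightarrow> count_list u z = 1 \<Longrightarrow> z \<in> set Q'"
  shows "prec B' p q"
proof -
  obtain b1 b2 where b: "B = b1 @ b2" "q \<notin> set b1" "p \<notin> set b2"
    using B by (auto simp: prec_def)
  have q: "q \<notin> set P" using determined by (simp add: determined_def)
  consider "p \<notin> set Q" | z Q1 Q2 where "Q = Q1 @ z # Q2" "count_list u z = 1" "p \<notin> set Q1" "q \<notin> set Q2"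
    using determined by (auto simp: determined_def)
  then show ?thesis
  proof cases
    case 1
    then have "prec u p q"
      using precI[of q "P @ b1" p "b2 @ Q"] b q by (simp add: u)
    then show ?thesis using ident_prec[OF id pq(1)] prec_infix v by metis
  next
    case 2
    have zpq: "p \<noteq> z" "q \<noteq> z" using 2 pq by auto
    have z: "z \<notin> set (P @ b1)" "z \<notin> set (b2 @ Q1)" "z \<notin> set Q2"
      using 2(1,2) lin_split[of "P @ b1 @ b2 @ Q1" z Q2] by (auto simp: u b)
    have "u = (P @ b1) @ (b2 @ Q1) @ z # Q2" using 2 b u by simp
    then have "prec_upto u {z} p q"
      by (rule prec_uptoI) (use 2 z b q in auto)
    then have "prec_upto v {z} p q" using ident_prec_upto[OF id pq(1) zpq] by simp
    then obtain w1 w2 w3 where w: "v = w1 @ w2 @ z # w3" "q \<notin> set w1" "p \<notin> set w2"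
      by (auto simp: prec_upto_def)
    have "z \<in> set Q'" using Q' 2 by simp
    then obtain Q1' Q2' where "Q' = Q1' @ z # Q2'" by (metis split_list)
    then have "v = (P' @ B' @ Q1') @ z # Q2'" "v = (w1 @ w2) @ z # w3" using v w by simp_all
    moreover have "count_list v z = 1" using ident_linear[OF id] 2 by simp
    ultimately have "P' @ B' @ Q1' = w1 @ w2" using lin_unique by metis
    moreover have "prec (w1 @ w2) p q" using w precI by metis
    ultimately show ?thesis using prec_infix by metis
  qed
qed

lemma ident_notin_tail:
  assumes id: "ident u v" and u: "u = P @ B @ z # R" and v: "v = P @ B' @ z # R'"
    and z: "count_list u z = 1" and p: "p \<notin> set (z # R)"
  shows "p \<notin> set (z # R')"
proof -
  have "z \<notin> set (P @ B)" using z lin_split[of "P @ B" z R] by (simp add: u)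
  then have "prec u p z" using precI[of z "P @ B" p "z # R"] p by (simp add: u)
  then have "prec ((P @ B') @ z # R') p z" using ident_prec[OF id, of p z] p by (simp add: v)
  then show ?thesis by (rule prec_tail)
qed

text \<open>Determinacy is itself preserved by identities. For a pair separated by a linear letter \<open>z\<close> other than the first
  letter \<open>z\<^sub>0\<close> of \<open>Q\<close>, the test for \<open>p, z\<^sub>0, z\<close> shows that no \<open>p\<close> moves between \<open>z\<^sub>0\<close> and \<open>z\<close>.\<close>

lemma determined_transfer:
  assumes id: "ident u v" and u: "u = P @ B @ Q" and v: "v = P @ B' @ Q'"
    and Q: "Q = [] \<and> Q' = [] \<or> (\<exists>z R R'. Q = z # R \<and> Q' = z # R' \<and> count_list u z = 1)"
    and determined: "determined (\<lambda>z. count_list u z = 1) P Q p q"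
    and pq: "count_list u p \<noteq> 1" "count_list u q \<noteq> 1"
  shows "determined (\<lambda>z. count_list v z = 1) P Q' p q"
proof -
  have lin: "count_list u z = 1 \<longleftrightarrow> count_list v z = 1" for z using ident_linear[OF id] .
  have q: "q \<notin> set P" using determined by (simp add: determined_def)
  show ?thesis
  proof (cases "Q = []")
    case True
    then show ?thesis using Q q by (auto simp: determined_def)
  next
    case False
    then obtain z0 R R' where z0: "Q = z0 # R" "Q' = z0 # R'" "count_list u z0 = 1" using Q by auto
    consider "p \<notin> set Q" | z Q1 Q2 where "Q = Q1 @ z # Q2" "count_list u z = 1" "p \<notin> set Q1" "q \<notin> set Q2"
      using determined by (auto simp: determined_def)
    then show ?thesis
    proof cases
      case 1
      then have "p \<notin> set Q'"
        using ident_notin_tail[OF id, of P B z0 R B' R' p] u v z0 by simp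
      then show ?thesis using q by (simp add: determined_def)
    next
      case 2
      have pz: "p \<noteq> z" "q \<noteq> z" "p \<noteq> z0" using 2 z0 pq by auto
      have "z \<notin> set (P @ B @ Q1)"
        using 2(1,2) lin_split[of "P @ B @ Q1" z Q2] by (simp add: u)
      then have "prec u q z"
        using precI[of z "P @ B @ Q1" q "z # Q2"] 2 pz by (simp add: u)
      then have qz: "prec v q z" using ident_prec[OF id] pz by metis
      show ?thesis
      proof (cases "z = z0")
        case True
        have "q \<notin> set (z # R')" using prec_tail[of "P @ B'" z R' q] qz by (simp add: v z0 True)
        then show ?thesis
          unfolding determined_def using q z0 lin True by (metis append_Nil empty_iff empty_set list.set_intros(2))
      next
        case False
        then obtain Q1' where Q1: "Q1 = z0 # Q1'" using 2(1) z0(1) by (cases Q1) auto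
        have n0: "z0 \<notin> set (P @ B)" "z0 \<notin> set Q2"
          using z0(3) lin_split[of "P @ B" z0 "Q1' @ z # Q2"] by (auto simp: u 2(1) Q1)
        have nz: "z \<notin> set (P @ B)" "z \<notin> set Q1" "z \<notin> set Q2"
          using 2(1,2) lin_split[of "P @ B @ Q1" z Q2] by (auto simp: u)
        have "u = (P @ B) @ Q1 @ z # Q2" using u 2 by simp
        then have "prec_upto u {z} p z0"
          by (rule prec_uptoI) (use n0 nz 2(3) in auto)
        then have "prec_upto v {z} p z0"
          using ident_prec_upto[OF id pz(3) pz(1)] False by simp
        then obtain w1 w2 w3 where w: "v = w1 @ w2 @ z # w3" "z0 \<notin> set w1" "z0 \<notin> set w3" "p \<notin> set w2"
          by (auto simp: prec_upto_def)
        have "z0 \<in> set v" using v z0 by simp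
        then have "z0 \<in> set w2" using w False by auto
        then obtain a b where ab: "w2 = a @ z0 # b" by (metis split_list)
        have "v = (w1 @ a) @ z0 # (b @ z # w3)" "v = (P @ B') @ z0 # R'"
          using w ab v z0 by simp_all
        then have R': "R' = b @ z # w3" using lin_unique[of v z0] lin z0(3) by metis
        then have "Q' = (z0 # b) @ z # w3" using z0 by simp
        moreover have "p \<notin> set (z0 # b)" using w ab by auto
        moreover have "q \<notin> set w3" using prec_tail[of "w1 @ w2" z w3 q] qz w by simp
        ultimately show ?thesis unfolding determined_def using q lin 2(2) by blast
      qed
    qed
  qed
qed

text \<open>A single block may be replaced by the corresponding block of the other word, although the words may still differ
  further to the right.\<close>

lemma deriv_block:
  assumes id: "ident u v" and u: "u = P @ B @ Q" and v: "v = P @ B' @ Q'"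
    and BB': "set B = set B'"
    and nlB: "\<forall>l\<in>set B. 2 \<le> count_list u l" and nlB': "\<forall>l\<in>set B'. 2 \<le> count_list v l"
    and P: "P = [] \<or> count_list u (last P) = 1"
    and Q: "Q = [] \<and> Q' = [] \<or> (\<exists>z R R'. Q = z # R \<and> Q' = z # R' \<and> count_list u z = 1)"
  shows "deriv (P @ B @ Q) (P @ B' @ Q)"
proof -
  let ?lin = "\<lambda>z. count_list u z = 1"
  let ?N = "{l. 2 \<le> count_list u l}"
  have lin: "count_list u z = 1 \<longleftrightarrow> count_list v z = 1" for z using ident_linear[OF id] .
  have tail: "l \<notin> set Q'" if "l \<notin> set Q" "\<not> ?lin l" for l
    using Q
  proof
    assume "\<exists>z R R'. Q = z # R \<and> Q' = z # R' \<and> count_list u z = 1"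
    then obtain z R R' where "Q = z # R" "Q' = z # R'" "count_list u z = 1" by auto
    then show ?thesis
      using ident_notin_tail[OF id, of P B z R B' R' l] u v that by simp
  qed simp
  have n: "nonlin P B Q" using nlB by (simp add: nonlin_def u)
  \<comment> \<open>In the mixed word \<open>PB'Q\<close> a letter of \<open>B'\<close> is not linear, because it occurs in \<open>Q\<close> if it occurs in \<open>Q'\<close>.\<close>
  have n': "nonlin P B' Q"
    unfolding nonlin_def
  proof
    fix l assume l: "l \<in> set B'"
    have 2: "2 \<le> count_list u l" "2 \<le> count_list v l" using l nlB nlB' BB' by auto
    have B'1: "count_list B' l \<noteq> 0" using l by (simp add: count_list_0_iff)
    show "2 \<le> count_list (P @ B' @ Q) l"
    proof (cases "l \<in> set P \<or> l \<in> set Q")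
      case True
      then have "count_list P l \<noteq> 0 \<or> count_list Q l \<noteq> 0" by (simp add: count_list_0_iff)
      then show ?thesis using B'1 by auto
    next
      case False
      then have "l \<notin> set Q'" using tail 2 by auto
      then show ?thesis using 2 by (simp add: v)
    qed
  qed
  obtain k where k: "arrangement (set B) k" "deriv (P @ B @ Q) (P @ map letter_of k @ Q)"
    "\<And>p q. p \<in> set B \<Longrightarrow> q \<in> set B \<Longrightarrow> p \<noteq> q \<Longrightarrow> before k (End p) (Start q) \<longleftrightarrow> prec B p q"
    using deriv_arrangement[OF n] by metis
  obtain k' where k': "arrangement (set B') k'" "deriv (P @ B' @ Q) (P @ map letter_of k' @ Q)"
    "\<And>p q. p \<in> set B' \<Longrightarrow> q \<in> set B' \<Longrightarrow> p \<noteq> q \<Longrightarrow> before k' (End p) (Start q) \<longleftrightarrow> prec B' p q"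
    using deriv_arrangement[OF n'] by metis
  \<comment> \<open>The pairs whose order in the block is visible neither in \<open>A\<^sup>1\<close> nor in \<open>B\<^sup>1\<close>.\<close>
  define undet where "undet p q \<longleftrightarrow> p \<noteq> q \<and> \<not> determined ?lin P Q p q \<and> \<not> determined ?lin (rev Q) (rev P) q p" for p q
  have "deriv (P @ map letter_of k @ Q) (P @ map letter_of k' @ Q)"
  proof (rule deriv_of_arrangements[where N = undet and A = "set B"])
    show "arrangement (set B) k" "arrangement (set B) k'" using k k' BB' by simp_all
  next
    fix p q c d
    assume undet: "undet p q" and A: "set (c @ [p, q] @ d) = set B" and n: "nonlin P (c @ [p, q] @ d) Q"
      and pq: "p \<in> set c" "q \<in> set d"
    have pqB: "\<not> ?lin p" "\<not> ?lin q" using A nlB by force+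
    have NQ: "l \<in> ?N" if "l \<in> set P \<union> set Q" "\<not> ?lin l" for l
    proof -
      have "count_list u l \<noteq> 0" using that by (auto simp: count_list_0_iff u)
      then show ?thesis using that by simp
    qed
    show "deriv (P @ c @ [p, q] @ d @ Q) (P @ c @ [q, p] @ d @ Q)"
    proof (rule deriv_swap_end_start[OF n pq, where N = ?N])
      show "\<forall>l\<in>?N. 2 \<le> count_list (P @ c @ [p, q] @ d @ Q) l"
      proof
        fix l assume l: "l \<in> ?N"
        show "2 \<le> count_list (P @ c @ [p, q] @ d @ Q) l"
        proof (cases "l \<in> set B")
          case True
          then show ?thesis using n[unfolded nonlin_def A append_assoc] by blast
        next
          case False
          then have "count_list B l = 0" by (simp add: count_list_0_iff)
          then show ?thesis using l by (simp add: u)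
        qed
      qed
      show "q \<in> set P \<or> after ?N Q p q"
        by (rule after_if_not_determined[of ?lin]) (use undet NQ Q pqB in \<open>auto simp: undet_def\<close>)
      have "p \<in> set (rev Q) \<or> after ?N (rev P) q p"
        by (rule after_if_not_determined[of ?lin]) (use undet NQ P pqB in \<open>auto simp: undet_def hd_rev\<close>)
      then show "p \<in> set Q \<or> after ?N (rev P) q p" by simp
    qed
  next
    fix p q assume pq: "p \<in> set B" "q \<in> set B" "p \<noteq> q" "\<not> undet p q"
    have pql: "count_list u p \<noteq> 1" "count_list u q \<noteq> 1" "count_list v p \<noteq> 1" "count_list v q \<noteq> 1"
      using pq nlB nlB' BB' by force+
    have sets: "set u = set v" by (rule ident_set[OF id])
    have Q1: "z \<in> set Q'" if "z \<in> set Q" "count_list u z = 1" for z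
    proof -
      have "z \<in> set v" using that sets u by auto
      moreover have "z \<notin> set B'" using that nlB BB' by auto
      moreover have "z \<notin> set P" using that by (auto simp: u count_list_0_iff dest!: split_list)
      ultimately show ?thesis by (simp add: v)
    qed
    have Q2: "z \<in> set Q" if "z \<in> set Q'" "count_list v z = 1" for z
    proof -
      have "z \<in> set u" using that sets v by auto
      moreover have "z \<notin> set B" using that nlB' BB' by auto
      moreover have "z \<notin> set P" using that by (auto simp: v count_list_0_iff dest!: split_list)
      ultimately show ?thesis by (simp add: u)
    qed
    \<comment> \<open>Pairs visible in \<open>B\<^sup>1\<close> are treated by reversal; the words to the right of the block are then equal.\<close>
    have ru: "rev u = rev Q @ rev B @ rev P" "rev v = rev Q' @ rev B' @ rev P" by (simp_all add: u v)
    have "prec B p q \<longleftrightarrow> prec B' p q"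
    proof (cases "determined ?lin P Q p q")
      case True
      then have t: "determined (\<lambda>z. count_list v z = 1) P Q' p q"
        using determined_transfer[OF id u v Q] pql by simp
      show ?thesis
        using ident_prec_of_determined[OF id u v True] ident_prec_of_determined[OF ident_sym[OF id] v u t]
          pq pql Q1 Q2 by blast
    next
      case False
      then have t: "determined ?lin (rev Q) (rev P) q p" using pq by (simp add: undet_def)
      then have "determined ?lin (rev Q') (rev P) q p" using tail pql by (auto simp: determined_def)
      then have t': "determined (\<lambda>z. count_list (rev v) z = 1) (rev Q') (rev P) q p" using lin by simp
      have t'': "determined (\<lambda>z. count_list (rev u) z = 1) (rev Q) (rev P) q p" using t by simp
      have "prec (rev B) q p \<longleftrightarrow> prec (rev B') q p"
        using ident_prec_of_determined[OF ident_rev[OF id] ru t''] pql pq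
          ident_prec_of_determined[OF ident_rev[OF ident_sym[OF id]] ru(2,1) t'] by auto
      then show ?thesis by (simp add: prec_rev)
    qed
    then show "before k (End p) (Start q) \<longleftrightarrow> before k' (End p) (Start q)"
      using k(3) k'(3) pq BB' by simp
  qed
  then show ?thesis using k(2) k'(2) deriv.trans deriv.sym by metis
qed

lemma ident_block_set:
  assumes id: "ident u v" and u: "u = P @ B @ z # Q" and v: "v = P @ B' @ z # Q'"
    and z: "count_list u z = 1" and P: "P = [] \<or> count_list u (last P) = 1" and l: "l \<in> set B"
  shows "l \<in> set B'"
proof (rule ccontr)
  assume l': "l \<notin> set B'"
  have zv: "count_list v z = 1" using z ident_linear[OF id] by simp
  have nz: "z \<notin> set (P @ B)" "z \<notin> set Q" "z \<notin> set (P @ B')" "z \<notin> set Q'"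
    using z zv lin_split[of "P @ B" z Q] lin_split[of "P @ B'" z Q'] by (auto simp: u v)
  have lz: "l \<noteq> z" using l nz by auto
  show False
  proof (cases P rule: rev_cases)
    case Nil
    have "prec v z l" using precI[of l "B' @ [z]" z Q'] l' lz nz by (simp add: v Nil)
    then have "prec (B @ z # Q) z l" using ident_prec[OF ident_sym[OF id]] lz u Nil by fastforce
    then show False using prec_head[of B z Q l] l by simp
  next
    case (snoc P0 z0)
    have z0: "count_list u z0 = 1" using P snoc by auto
    then have z0v: "count_list v z0 = 1" using ident_linear[OF id] by simp
    have n0: "z0 \<notin> set P0" "z0 \<notin> set (B @ z # Q)" "z0 \<notin> set (B' @ z # Q')"
      using z0 z0v lin_split[of P0 z0 "B @ z # Q"] lin_split[of P0 z0 "B' @ z # Q'"]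
      by (auto simp: u v snoc)
    \<comment> \<open>The test for \<open>l, z\<^sub>0, z\<close> detects whether \<open>l\<close> occurs between the neighbouring linear letters \<open>z\<^sub>0\<close> and \<open>z\<close>.\<close>
    have v2: "v = P0 @ (z0 # B') @ z # Q'" by (simp add: v snoc)
    have "prec_upto v {z} l z0"
      by (rule prec_uptoI[OF v2]) (use nz n0 snoc l l' in auto)
    then have "prec_upto u {z} l z0"
      using ident_prec_upto[OF ident_sym[OF id], of l z0 z] lz n0 l by auto
    then obtain w1 w2 w3 where w: "u = w1 @ w2 @ z # w3" "z0 \<notin> set w1" "z0 \<notin> set w3" "l \<notin> set w2"
      by (auto simp: prec_upto_def)
    have "z0 \<in> set u" by (simp add: u snoc)
    then have "z0 \<in> set w2" using w n0 by auto
    then obtain a b where ab: "w2 = a @ z0 # b" by (metis split_list)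
    have "u = (w1 @ a) @ z0 # (b @ z # w3)" "u = P0 @ z0 # (B @ z # Q)"
      using w ab u snoc by simp_all
    then have "b @ z # w3 = B @ z # Q" using lin_unique[OF z0] by metis
    moreover have "count_list (B @ z # Q) z = 1" unfolding lin_split using nz by simp
    ultimately have "b = B" using lin_unique by metis
    then show False using w ab l by simp
  qed
qed

text \<open>\<open>P\<close> is the prefix on which the two words already agree; it ends at a block boundary.\<close>

lemma deriv_of_ident_prefix:
  "ident (P @ u) (P @ v) \<Longrightarrow> P = [] \<or> count_list (P @ u) (last P) = 1 \<Longrightarrow> deriv (P @ u) (P @ v)"
proof (induction "length u" arbitrary: P u v rule: less_induct)
  case less
  note id = less.prems(1) and P = less.prems(2)
  have lin: "count_list (P @ u) z = 1 \<longleftrightarrow> count_list (P @ v) z = 1" for z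
    using ident_linear[OF id] .
  have sets: "set (P @ u) = set (P @ v)" by (rule ident_set[OF id])
  have notP: "z \<notin> set P" if "z \<in> set w" "count_list (P @ w) z = 1" for z w
    using that by (auto simp: count_list_0_iff dest!: split_list)
  have big: "2 \<le> count_list (P @ w) l" if "l \<in> set w" "count_list (P @ w) l \<noteq> 1" for l w
  proof -
    have "count_list w l \<noteq> 0" using that by (simp add: count_list_0_iff)
    then show ?thesis using that by simp
  qed
  have mem: "z \<in> set v \<longleftrightarrow> z \<in> set u" if "count_list (P @ u) z = 1" for z
    using that lin sets notP[of z u] notP[of z v] by auto
  show ?case
  proof (cases "\<exists>z\<in>set u. count_list (P @ u) z = 1")
    case False
    then have nl': "\<forall>l\<in>set v. count_list (P @ v) l \<noteq> 1" using lin mem by blast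
    have "set u = set v"
    proof (cases P rule: rev_cases)
      case Nil
      then show ?thesis using sets by simp
    next
      case (snoc P0 z0)
      have "count_list (P @ u) z0 = 1" using P snoc by simp
      then have z0: "count_list (P @ u) z0 = 1" "count_list (P @ v) z0 = 1" using lin[of z0] by blast+
      have "l \<in> set u \<longleftrightarrow> l \<in> set v" if "l \<noteq> z0" for l
        using ident_notin_tail[OF id, of P0 "[]" z0 u "[]" v l] z0 that
          ident_notin_tail[OF ident_sym[OF id], of P0 "[]" z0 v "[]" u l] by (auto simp: snoc)
      moreover have "z0 \<notin> set u" "z0 \<notin> set v"
        using z0 lin_split[of P0 z0 u] lin_split[of P0 z0 v] by (auto simp: snoc)
      ultimately show ?thesis by (metis subsetI subset_antisym)
    qed
    then have "deriv (P @ u @ []) (P @ v @ [])"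
      by (intro deriv_block[OF id]) (use False nl' big P in auto)
    then show ?thesis by simp
  next
    case True
    then obtain B z Q where u: "u = B @ z # Q" "count_list (P @ u) z = 1"
      and B: "\<forall>l\<in>set B. count_list (P @ u) l \<noteq> 1"
      using split_list_first_prop[of u "\<lambda>z. count_list (P @ u) z = 1"] by auto
    have "z \<in> set v" using mem[OF u(2)] u(1) by simp
    then have "\<exists>z\<in>set v. count_list (P @ v) z = 1" using u(2) lin by blast
    then obtain B' z' Q' where v: "v = B' @ z' # Q'" "count_list (P @ v) z' = 1"
      and B': "\<forall>l\<in>set B'. count_list (P @ v) l \<noteq> 1"
      using split_list_first_prop[of v "\<lambda>z. count_list (P @ v) z = 1"] by auto
    have zP: "z \<notin> set P" "z' \<notin> set P" using notP[of z u] notP[of z' v] u v by auto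
    have "z' = z"
    proof (rule ccontr)
      assume ne: "z' \<noteq> z"
      have "z' \<notin> set B" using B v(2) lin by blast
      moreover have "z \<notin> set Q" using u lin_split[of "P @ B" z Q] by simp
      ultimately have "prec (P @ u) z z'"
        using precI[of z' "P @ B @ [z]" z Q] zP ne by (simp add: u(1))
      then have "prec ((P @ B') @ z' # Q') z z'"
        using ident_prec[OF id ne[symmetric]] by (simp add: v(1))
      then have "z \<notin> set (z' # Q')" by (rule prec_tail)
      moreover have "z \<notin> set B'" using B' u(2) lin by blast
      ultimately show False using \<open>z \<in> set v\<close> by (simp add: v(1))
    qed
    note v = v[unfolded this]
    have "set B = set B'"
    proof
      show "set B \<subseteq> set B'"
        using ident_block_set[OF id, of P B z Q B' Q'] u v P by auto
      show "set B' \<subseteq> set B"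
        using ident_block_set[OF ident_sym[OF id], of P B' z Q' B Q] u v P lin by auto
    qed
    then have "deriv (P @ B @ z # Q) (P @ B' @ z # Q)"
      using B B' big[of _ u] big[of _ v] P u v
      by (intro deriv_block[OF id, where Q' = "z # Q'"]) auto
    then have 1: "deriv (P @ u) ((P @ B' @ [z]) @ Q)" by (simp add: u(1))
    \<comment> \<open>The derivation is sound, so what remains is again an identity.\<close>
    have id2: "ident ((P @ B' @ [z]) @ Q) ((P @ B' @ [z]) @ Q')"
      using ident_trans[OF ident_sym[OF deriv_ident[OF 1]] id] by (simp add: v(1))
    have "count_list ((P @ B' @ [z]) @ Q) z = 1"
      using ident_linear[OF deriv_ident[OF 1]] u(2) by simp
    then have "deriv ((P @ B' @ [z]) @ Q) ((P @ B' @ [z]) @ Q')"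
      by (intro less.hyps[OF _ id2]) (simp_all add: u(1))
    then show ?thesis using deriv.trans[OF 1] by (simp add: v(1))
  qed
qed

theorem deriv_iff_ident: "deriv u v \<longleftrightarrow> ident u v"
  using deriv_ident deriv_of_ident_prefix[of "[]"] by auto

section \<open>The generated variety\<close>

lemma basis_nonempty: "e \<in> basis \<Longrightarrow> fst e \<noteq> [] \<and> snd e \<noteq> []"
  by (auto simp: basis_def)

lemma satisfies_HSP:
  fixes S :: "'b sgrp" and T :: "'a sgrp" and e :: "'v identity"
  assumes "HSP TYPE('i) S T" "satisfies S e" and ne: "fst e \<noteq> []" "snd e \<noteq> []"
  shows "satisfies T e"
proof -
  obtain I :: "'i set" and U h where U: "subsemigroup U (direct_power S I)"
    and h: "surj_hom h (restrict_to (direct_power S I) U) T"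
    using assms(1) unfolding HSP_def by blast
  let ?D = "direct_power S I"
  have U_sub: "U \<subseteq> (\<Pi>\<^sub>E i\<in>I. carrier S)"
    and U_cl: "\<And>v w. v \<in> U \<Longrightarrow> w \<in> U \<Longrightarrow> v \<cdot>\<^bsub>?D\<^esub> w \<in> U"
    using U by (auto simp: subsemigroup_def direct_power_def)
  have at: "(v \<cdot>\<^bsub>?D\<^esub> w) i = v i \<cdot>\<^bsub>S\<^esub> w i" if "i \<in> I" for v w i
    using that by (simp add: direct_power_def)
  have h_im: "h ` U = carrier T"
    and h_hom: "\<And>v w. v \<in> U \<Longrightarrow> w \<in> U \<Longrightarrow> h (v \<cdot>\<^bsub>?D\<^esub> w) = h v \<cdot>\<^bsub>T\<^esub> h w"
    using h by (auto simp: surj_hom_def restrict_to_def)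
  show ?thesis
    unfolding satisfies_def
  proof (intro allI impI)
    fix \<theta> :: "'v \<Rightarrow> 'a" assume \<theta>: "\<forall>v. \<theta> v \<in> carrier T"
    define \<eta> where "\<eta> v = inv_into U h (\<theta> v)" for v
    have \<eta>: "\<eta> v \<in> U" "h (\<eta> v) = \<theta> v" for v
      using \<theta> h_im unfolding \<eta>_def by (metis inv_into_into, metis f_inv_into_f)
    have val: "word_val ?D \<eta> w \<in> U \<and> h (word_val ?D \<eta> w) = word_val T \<theta> w \<and>
        (\<forall>i\<in>I. word_val ?D \<eta> w i = word_val S (\<lambda>v. \<eta> v i) w)" if "w \<noteq> []" for w
      using that
    proof (induction w rule: list_nonempty_induct)
      case (single a)
      then show ?case using \<eta> by simp
    next
      case (cons a w)
      then obtain b w' where "w = b # w'" by (cases w) auto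
      then show ?case
        using cons \<eta> U_cl h_hom at by simp
    qed
    have "word_val S (\<lambda>v. \<eta> v i) (fst e) = word_val S (\<lambda>v. \<eta> v i) (snd e)" if "i \<in> I" for i
    proof -
      have "\<eta> v i \<in> carrier S" for v using \<eta>(1)[of v] U_sub that by (auto simp: PiE_iff)
      then show ?thesis using assms(2) by (simp add: satisfies_def)
    qed
    then have "word_val ?D \<eta> (fst e) = word_val ?D \<eta> (snd e)"
      using val[OF ne(1)] val[OF ne(2)] U_sub by (intro PiE_ext[of _ I "\<lambda>_. carrier S"]) auto
    then show "word_val T \<theta> (fst e) = word_val T \<theta> (snd e)"
      using val[OF ne(1)] val[OF ne(2)] by simp
  qed
qed

text \<open>One half of Birkhoff's theorem. The words over \<open>T\<close>, as functions of the substitutions of elements of \<open>S\<close> for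
  the elements of \<open>T\<close>, form a subsemigroup of a power of \<open>S\<close>; evaluation in \<open>T\<close> maps it onto \<open>T\<close> and is well defined
  by the assumption on identities.\<close>

lemma HSP_of_identities:
  fixes T :: "'a sgrp" and S :: "'b sgrp"
  assumes T: "semigrp T" and S: "semigrp S" "carrier S = UNIV"
    and id: "\<And>(u :: 'a list) v. u \<noteq> [] \<Longrightarrow> v \<noteq> [] \<Longrightarrow> satisfies S (u, v) \<Longrightarrow> satisfies T (u, v)"
  shows "HSP TYPE('a \<Rightarrow> 'b) S T"
proof -
  interpret T: semigrp T by fact
  interpret S: semigrp S by fact
  let ?I = "UNIV :: ('a \<Rightarrow> 'b) set"
  let ?D = "direct_power S ?I"
  define W where "W = {w :: 'a list. w \<noteq> [] \<and> set w \<subseteq> carrier T}"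
  define fn where "fn w = (\<lambda>\<theta>. word_val S \<theta> w)" for w :: "'a list"
  obtain c where c: "c \<in> carrier T" using T.nonempty by blast
  \<comment> \<open>Words over \<open>T\<close> are evaluated letter by letter; letters outside the carrier do not matter and go to \<open>c\<close>.\<close>
  define \<theta>\<^sub>0 where "\<theta>\<^sub>0 a = (if a \<in> carrier T then a else c)" for a
  define ev where "ev = word_val T \<theta>\<^sub>0"
  have th: "\<theta>\<^sub>0 a \<in> carrier T" for a using c by (simp add: \<theta>\<^sub>0_def)
  have ev_eq: "ev u = ev v" if "u \<in> W" "v \<in> W" "fn u = fn v" for u v
  proof -
    have "satisfies T (u, v)"
      using that by (intro id) (auto simp: W_def fn_def satisfies_def fun_eq_iff)
    then show ?thesis using th by (simp add: satisfies_def ev_def)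
  qed
  have D: "f \<cdot>\<^bsub>?D\<^esub> g = (\<lambda>\<theta>. f \<theta> \<cdot>\<^bsub>S\<^esub> g \<theta>)" for f g
    by (simp add: direct_power_def restrict_def)
  have fn_append: "fn u \<cdot>\<^bsub>?D\<^esub> fn v = fn (u @ v)" if "u \<in> W" "v \<in> W" for u v
    using that S by (simp add: D fn_def W_def S.word_val_append)
  have ev_append: "ev (u @ v) = ev u \<cdot>\<^bsub>T\<^esub> ev v" if "u \<in> W" "v \<in> W" for u v
    using that T.word_val_append[of \<theta>\<^sub>0] th by (simp add: ev_def W_def)
  have W_append: "u @ v \<in> W" if "u \<in> W" "v \<in> W" for u v
    using that by (simp add: W_def)
  define h where "h f = ev (SOME w. w \<in> W \<and> fn w = f)" for f
  have h: "h (fn w) = ev w" if "w \<in> W" for w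
  proof -
    have "(SOME u. u \<in> W \<and> fn u = fn w) \<in> W \<and> fn (SOME u. u \<in> W \<and> fn u = fn w) = fn w"
      by (rule someI[of "\<lambda>u. u \<in> W \<and> fn u = fn w" w]) (use that in simp)
    then show ?thesis unfolding h_def using that ev_eq by blast
  qed
  have one: "[a] \<in> W \<and> ev [a] = a" if "a \<in> carrier T" for a
    using that by (simp add: W_def ev_def \<theta>\<^sub>0_def)
  have ev_in: "ev w \<in> carrier T" if "w \<in> W" for w
    using that T.word_val_closed[of \<theta>\<^sub>0] th by (simp add: ev_def W_def)
  have "subsemigroup (fn ` W) ?D"
    unfolding subsemigroup_def
  proof (intro conjI ballI)
    show "fn ` W \<subseteq> carrier ?D" by (simp add: direct_power_def S(2))
    show "fn ` W \<noteq> {}" using one[OF c] by blast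
    show "f \<cdot>\<^bsub>?D\<^esub> g \<in> fn ` W" if "f \<in> fn ` W" "g \<in> fn ` W" for f g
      using that fn_append W_append by auto
  qed
  moreover have "surj_hom h (restrict_to ?D (fn ` W)) T"
    unfolding surj_hom_def restrict_to_def sgrp.simps
  proof (intro conjI ballI)
    have "h ` fn ` W = ev ` W" using h by (simp add: image_image)
    also have "\<dots> = carrier T" using one ev_in by (metis (no_types, lifting) image_subsetI image_eqI subsetI subset_antisym)
    finally show "h ` fn ` W = carrier T" .
    show "h (f \<cdot>\<^bsub>?D\<^esub> g) = h f \<cdot>\<^bsub>T\<^esub> h g" if "f \<in> fn ` W" "g \<in> fn ` W" for f g
      using that h fn_append W_append ev_append by force
  qed
  ultimately show ?thesis unfolding HSP_def by blast
qed

theorem theorem3p1: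
  shows "(var_gen A1xB1 :: 'a sgrp set) = var_defined_by basis"
proof (intro set_eqI iffI)
  fix T :: "'a sgrp"
  assume "T \<in> var_gen A1xB1"
  then have T: "semigrp T" and hsp: "HSP TYPE('a \<Rightarrow> elt option \<times> elt option) A1xB1 T"
    by (auto simp: var_gen_def)
  have "satisfies T e" if e: "e \<in> basis" for e
  proof (rule satisfies_HSP[OF hsp])
    show ne: "fst e \<noteq> []" "snd e \<noteq> []" using basis_nonempty[OF e] by auto
    show "satisfies A1xB1 e"
      using ident_iff_satisfies[OF ne] basis_ident[OF e] by simp
  qed
  then show "T \<in> var_defined_by basis" using T by (simp add: var_defined_by_def)
next
  fix T :: "'a sgrp"
  assume "T \<in> var_defined_by basis"
  then have T: "semigrp T" and sat: "\<forall>e\<in>basis. satisfies T e"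
    by (auto simp: var_defined_by_def)
  have "HSP TYPE('a \<Rightarrow> elt option \<times> elt option) A1xB1 T"
  proof (rule HSP_of_identities[OF T semigrp_A1xB1 carrier_A1xB1])
    fix u v :: "'a list"
    assume "u \<noteq> []" "v \<noteq> []" "satisfies A1xB1 (u, v)"
    then have "deriv u v" by (simp add: ident_iff_satisfies deriv_iff_ident)
    then show "satisfies T (u, v)"
      using semigrp.deriv_sound[OF T _ sat, of u v] by (simp add: satisfies_def)
  qed
  then show "T \<in> var_gen A1xB1" using T by (simp add: var_gen_def)
qed

end
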